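(* Let $S$ be a convex monotone $C_0$-semigroup on $X$ which is continuous from above, with monotone generator $A_\delta$, and let $T$ be a convex $C_0$-semigroup on $X$ with generator $B$ and monotone generator $B_\delta$ such that $B_\delta\subset A_\delta$ (that is, $D(B_\delta)\subset D(A_\delta)$ and $B_\delta x=A_\delta x$ for all $x\in D(B_\delta)$). If $\overline{D(B)}=X$ (norm closure), then $S(t)=T(t)$ for all $t\ge0$.
   Context: Standing setting: $X$ is a real Banach lattice which is a Riesz subspace of a Dedekind $\sigma$-complete Riesz space $\overline X$. For a sequence $(x_n)_{n\in\mathbb{N}}$, write $x_n\downarrow x$ if $(x_n)$ is decreasing, bounded from below (by an element of $X$), and $x=\inf_n x_n\in\overline X$. Let $X_\delta:=\{x\in\overline X\colon x_n\downarrow x \text{ for some sequence }(x_n)_{n\in\mathbb{N}}\text{ in }X\}$. Let $M$ be the space of all positive linear functionals $\mu\colon X\to\mathbb{R}$ that are continuous from above, i.e. $\mu x_n\downarrow 0$ for every sequence $(x_n)$ in $X$ with $x_n\downarrow 0$. Every $\mu\in M$ has a unique extension $\mu\colon X_\delta\to\mathbb{R}$ which is continuous from above, i.e. $\mu x_n\downarrow\mu x$ for every sequence $(x_n)$ in $X_\delta$ with $x_n\downarrow x\in X_\delta$. It is assumed that $M$ separates the points of $X_\delta$. An operator $T\colon X\to X$ is convex if $T(\lambda x+(1-\lambda)y)\le\lambda Tx+(1-\lambda)Ty$ for all $x,y\in X$, $\lambda\in[0,1]$; monotone if $x\le y$ implies $Tx\le Ty$; bounded if $\sup_{\|x\|\le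 r}\|Tx\|<\infty$ for all $r>0$. A $C_0$-semigroup on $X$ is a family $S=(S(t))_{t\ge0}$ of bounded (possibly nonlinear) operators $X\to X$ with $S(0)x=x$, $S(t+s)x=S(t)S(s)x$ for all $s,t\ge0$, and $S(t)x\to x$ in norm as $t\downarrow 0$, for all $x\in X$. It is convex (monotone) if each $S(t)$ is. A monotone $C_0$-semigroup is continuous from above if $S(t)x_n\downarrow S(t)0$ for all $t\ge0$ and every sequence $(x_n)$ in $X$ with $x_n\downarrow 0$. For a convex $C_0$-semigroup $S$: the generator $A$ has domain $D(A)$ consisting of all $x\in X$ such that $\frac{S(h)x-x}{h}$ converges in norm in $X$ as $h\downarrow0$, and $Ax$ is the limit. The monotone generator $A_\delta$ has domain $D(A_\delta)$ consisting of all $x\in X$ such that for every sequence $(h_n)$ in $(0,\infty)$ with $h_n\downarrow0$ there exist a sequence $(A_nx)_{n\in\mathbb{N}}$ in $X$ and some $y\in X_\delta$ with $\big\|\frac{S(h_n)x-x}{h_n}-A_nx\big\|\to0$ and $A_nx\downarrow y$; then $y$ is uniquely determined and $A_\delta x:=y$. The generators $B$, $B_\delta$ of $T$ are defined in the same way with $T$ in place of $S$. *)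

theory Defs
  imports "HOL-Analysis.Analysis" "HOL-Library.Lattice_Algebras"
begin

class riesz_space = ordered_real_vector + lattice_ab_group_add

class sigma_complete_riesz_space = riesz_space +
  assumes countable_bounded_has_sup:
    "countable C \<Longrightarrow> C \<noteq> {} \<Longrightarrow> (\<exists>b. \<forall>c\<in>C. c \<le> b) \<Longrightarrow>
      \<exists>s. (\<forall>c\<in>C. c \<le> s) \<and> (\<forall>b. (\<forall>c\<in>C. c \<le> b) \<longrightarrow> s \<le> b)"

(* The modulus is the lattice modulus: abs_lattice states \<bar>x\<bar> = sup x (- x). *)
class banach_lattice = banach + riesz_space + lattice_ab_group_add_abs +
  assumes lattice_norm: "\<bar>x\<bar> \<le> \<bar>y\<bar> \<Longrightarrow> norm x \<le> norm y"

(* X is a type 'a and its ambient space a type 'b; "X is a Riesz subspace" is expressed by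
   an embedding of X as a Riesz subspace. It is automatically an order embedding, since
   x \<le> y iff sup x y = y. *)
definition riesz_embedding :: "('a::riesz_space \<Rightarrow> 'b::riesz_space) \<Rightarrow> bool" where
  "riesz_embedding \<iota> \<longleftrightarrow> linear \<iota> \<and> inj \<iota> \<and>
     (\<forall>x y. \<iota> (sup x y) = sup (\<iota> x) (\<iota> y)) \<and>
     (\<forall>x y. \<iota> (inf x y) = inf (\<iota> x) (\<iota> y))"

definition is_glb :: "'b::order set \<Rightarrow> 'b \<Rightarrow> bool" where
  "is_glb C y \<longleftrightarrow> (\<forall>c\<in>C. y \<le> c) \<and> (\<forall>z. (\<forall>c\<in>C. z \<le> c) \<longrightarrow> z \<le> y)"

(* x_n \<down> y. The infimum is taken in the ambient space; the lower bound has to lie in X. *)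
definition decr_to ::
  "('a::riesz_space \<Rightarrow> 'b::riesz_space) \<Rightarrow> (nat \<Rightarrow> 'b) \<Rightarrow> 'b \<Rightarrow> bool" where
  "decr_to \<iota> x y \<longleftrightarrow> decseq x \<and> (\<exists>z. \<forall>n. \<iota> z \<le> x n) \<and> is_glb (range x) y"

definition X_delta :: "('a::riesz_space \<Rightarrow> 'b::riesz_space) \<Rightarrow> 'b set" where
  "X_delta \<iota> = {y. \<exists>x. decr_to \<iota> (\<lambda>n. \<iota> (x n)) y}"

definition real_decr_to :: "(nat \<Rightarrow> real) \<Rightarrow> real \<Rightarrow> bool" where
  "real_decr_to r l \<longleftrightarrow> decseq r \<and> r \<longlonglongrightarrow> l"

definition M_functionals :: "('a::riesz_space \<Rightarrow> 'b::riesz_space) \<Rightarrow> ('a \<Rightarrow> real) set" where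
  "M_functionals \<iota> = {\<mu>. linear \<mu> \<and> (\<forall>x\<ge>0. 0 \<le> \<mu> x) \<and>
     (\<forall>x. decr_to \<iota> (\<lambda>n. \<iota> (x n)) 0 \<longrightarrow> real_decr_to (\<lambda>n. \<mu> (x n)) 0)}"

(* The values of \<nu> outside X_delta are irrelevant. *)
definition delta_extension ::
  "('a::riesz_space \<Rightarrow> 'b::riesz_space) \<Rightarrow> ('a \<Rightarrow> real) \<Rightarrow> ('b \<Rightarrow> real) \<Rightarrow> bool" where
  "delta_extension \<iota> \<mu> \<nu> \<longleftrightarrow> (\<forall>x. \<nu> (\<iota> x) = \<mu> x) \<and>
     (\<forall>x y. (\<forall>n. x n \<in> X_delta \<iota>) \<longrightarrow> y \<in> X_delta \<iota> \<longrightarrow> decr_to \<iota> x y \<longrightarrow>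
        real_decr_to (\<lambda>n. \<nu> (x n)) (\<nu> y))"

(* The extension \<nu> of \<mu> exists and is unique on X_delta. *)
definition M_separates :: "('a::riesz_space \<Rightarrow> 'b::riesz_space) \<Rightarrow> bool" where
  "M_separates \<iota> \<longleftrightarrow> (\<forall>x\<in>X_delta \<iota>. \<forall>y\<in>X_delta \<iota>. x \<noteq> y \<longrightarrow>
     (\<exists>\<mu>\<in>M_functionals \<iota>. \<exists>\<nu>. delta_extension \<iota> \<mu> \<nu> \<and> \<nu> x \<noteq> \<nu> y))"

definition convex_op :: "('a::banach_lattice \<Rightarrow> 'a) \<Rightarrow> bool" where
  "convex_op F \<longleftrightarrow> (\<forall>x y. \<forall>c\<in>{0..1}.
     F (c *\<^sub>R x + (1 - c) *\<^sub>R y) \<le> c *\<^sub>R F x + (1 - c) *\<^sub>R F y)"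

definition bounded_op :: "('a::banach_lattice \<Rightarrow> 'a) \<Rightarrow> bool" where
  "bounded_op F \<longleftrightarrow> (\<forall>r>0. bdd_above {norm (F x) |x. norm x \<le> r})"

(* A family indexed by all reals; only the members with t \<ge> 0 matter. *)
definition C0_semigroup :: "(real \<Rightarrow> 'a::banach_lattice \<Rightarrow> 'a) \<Rightarrow> bool" where
  "C0_semigroup S \<longleftrightarrow> (\<forall>t\<ge>0. bounded_op (S t)) \<and> (\<forall>x. S 0 x = x) \<and>
     (\<forall>s\<ge>0. \<forall>t\<ge>0. \<forall>x. S (t + s) x = S t (S s x)) \<and>
     (\<forall>x. ((\<lambda>t. S t x) \<longlongrightarrow> x) (at_right 0))"

definition convex_C0_semigroup :: "(real \<Rightarrow> 'a::banach_lattice \<Rightarrow> 'a) \<Rightarrow> bool" where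
  "convex_C0_semigroup S \<longleftrightarrow> C0_semigroup S \<and> (\<forall>t\<ge>0. convex_op (S t))"

definition monotone_semigroup :: "(real \<Rightarrow> 'a::banach_lattice \<Rightarrow> 'a) \<Rightarrow> bool" where
  "monotone_semigroup S \<longleftrightarrow> (\<forall>t\<ge>0. mono (S t))"

definition continuous_from_above ::
  "('a::banach_lattice \<Rightarrow> 'b::riesz_space) \<Rightarrow> (real \<Rightarrow> 'a \<Rightarrow> 'a) \<Rightarrow> bool" where
  "continuous_from_above \<iota> S \<longleftrightarrow> (\<forall>t\<ge>0. \<forall>x. decr_to \<iota> (\<lambda>n. \<iota> (x n)) 0 \<longrightarrow>
     decr_to \<iota> (\<lambda>n. \<iota> (S t (x n))) (\<iota> (S t 0)))"

definition diff_quot :: "(real \<Rightarrow> 'a::banach_lattice \<Rightarrow> 'a) \<Rightarrow> real \<Rightarrow> 'a \<Rightarrow> 'a" where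
  "diff_quot S h x = (S h x - x) /\<^sub>R h"

definition generator_graph :: "(real \<Rightarrow> 'a::banach_lattice \<Rightarrow> 'a) \<Rightarrow> 'a \<Rightarrow> 'a \<Rightarrow> bool" where
  "generator_graph S x y \<longleftrightarrow> ((\<lambda>h. diff_quot S h x) \<longlongrightarrow> y) (at_right 0)"

definition generator_dom :: "(real \<Rightarrow> 'a::banach_lattice \<Rightarrow> 'a) \<Rightarrow> 'a set" where
  "generator_dom S = {x. \<exists>y. generator_graph S x y}"

definition null_seq_pos :: "(nat \<Rightarrow> real) \<Rightarrow> bool" where
  "null_seq_pos h \<longleftrightarrow> (\<forall>n. 0 < h n) \<and> real_decr_to h 0"

definition mono_gen_along ::
  "('a::banach_lattice \<Rightarrow> 'b::riesz_space) \<Rightarrow> (real \<Rightarrow> 'a \<Rightarrow> 'a) \<Rightarrow> (nat \<Rightarrow> real) \<Rightarrow> 'a \<Rightarrow> 'b \<Rightarrow> bool"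
  where
  "mono_gen_along \<iota> S h x y \<longleftrightarrow> y \<in> X_delta \<iota> \<and>
     (\<exists>a. (\<lambda>n. norm (diff_quot S (h n) x - a n)) \<longlonglongrightarrow> 0 \<and> decr_to \<iota> (\<lambda>n. \<iota> (a n)) y)"

definition mono_generator_dom ::
  "('a::banach_lattice \<Rightarrow> 'b::riesz_space) \<Rightarrow> (real \<Rightarrow> 'a \<Rightarrow> 'a) \<Rightarrow> 'a set" where
  "mono_generator_dom \<iota> S = {x. \<forall>h. null_seq_pos h \<longrightarrow> (\<exists>y. mono_gen_along \<iota> S h x y)}"

(* When M separates the points of X_delta, y is unique for each h and does not depend on h:
   two sequences have subsequences that interlace into a single decreasing one. *)
definition mono_generator ::
  "('a::banach_lattice \<Rightarrow> 'b::riesz_space) \<Rightarrow> (real \<Rightarrow> 'a \<Rightarrow> 'a) \<Rightarrow> 'a \<Rightarrow> 'b" where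
  "mono_generator \<iota> S x = (THE y. \<forall>h. null_seq_pos h \<longrightarrow> mono_gen_along \<iota> S h x y)"

end

theory Submission
  imports Defs
begin

text \<open>Take \<open>x\<close> in the domain of \<open>B\<close>. By convexity the quotients \<open>(T s (x + h B x) - T s x) / h\<close> decrease
  as \<open>h\<close> decreases to 0, and local Lipschitz continuity makes them asymptotic to the difference quotients of
  \<open>T\<close> at \<open>T s x\<close>; so the orbit stays in the domain of the monotone generator. For \<open>\<mu>\<close> in \<open>M\<close> put
  \<open>g r s = \<mu> (S r (T s x))\<close>. As \<open>S\<close> and \<open>T\<close> have the same monotone generator at \<open>T s x\<close>, continuity from above
  gives \<open>(g r (s + h) - g (r + h) s) / h \<longrightarrow> 0\<close> for every fixed \<open>r\<close>, boundedly in \<open>r\<close>. Hence by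
  dominated convergence the integral of \<open>g (u - s) s\<close> over \<open>u\<close> in \<open>{t..b}\<close> does not depend on \<open>s\<close> in \<open>{0..t}\<close>.
  Letting \<open>b\<close> decrease to \<open>t\<close> yields \<open>\<mu> (S t x) = \<mu> (T t x)\<close>; \<open>M\<close> separates points and the domain is dense.\<close>

subsection \<open>Banach lattices and convex operators\<close>

lemma norm_abs_eq [simp]: "norm \<bar>x\<bar> = norm (x :: 'a::banach_lattice)"
  by (intro antisym lattice_norm) simp_all

text \<open>Convexity yields order bounds, while the Banach lattice norm sees only moduli. The
  bridge is \<open>|x| <= |a| + |b|\<close>.\<close>

lemma norm_le_of_order_bounds:
  fixes x :: "'a::banach_lattice"
  assumes "a \<le> x" "x \<le> b"
  shows "norm x \<le> norm a + norm b"
proof -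
  have "x \<le> \<bar>a\<bar> + \<bar>b\<bar>"
    using assms(2) abs_ge_self[of b] abs_ge_zero[of a] by (metis add_increasing order_trans)
  moreover have "- x \<le> \<bar>a\<bar> + \<bar>b\<bar>"
    using assms(1) abs_ge_minus_self[of a] abs_ge_zero[of b]
    by (meson add_increasing2 neg_le_iff_le order_trans)
  ultimately have "\<bar>x\<bar> \<le> \<bar>\<bar>a\<bar> + \<bar>b\<bar>\<bar>"
    by (simp add: abs_leI)
  then have "norm x \<le> norm (\<bar>a\<bar> + \<bar>b\<bar>)"
    by (rule lattice_norm)
  also have "\<dots> \<le> norm a + norm b"
    by (metis norm_abs_eq norm_triangle_ineq)
  finally show ?thesis .
qed

lemma convex_opD:
  "convex_op F \<Longrightarrow> 0 \<le> c \<Longrightarrow> c \<le> 1 \<Longrightarrow>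
    F (c *\<^sub>R x + (1 - c) *\<^sub>R y) \<le> c *\<^sub>R F x + (1 - c) *\<^sub>R F y"
  by (simp add: convex_op_def)

lemma convex_op_increment:
  assumes "convex_op F" "0 \<le> c" "c \<le> 1"
  shows "F (x + c *\<^sub>R v) - F x \<le> c *\<^sub>R (F (x + v) - F x)"
  using convex_opD[OF assms, of "x + v" x] by (simp add: algebra_simps)

text \<open>Extend the segment from \<open>x\<close> through \<open>x'\<close> until it has length
  \<open>2 * r\<close>. Convexity bounds the increment at \<open>x'\<close> by the matching fraction
  of the increment at the far end, where \<open>F\<close> is bounded by \<open>C\<close>.\<close>

lemma convex_op_diff_le:
  fixes F :: "'a::banach_lattice \<Rightarrow> 'a"
  assumes F: "convex_op F" and r: "r > 0"
    and bd: "\<And>z. z \<in> cball x0 (3 * r) \<Longrightarrow> norm (F z) \<le> C"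
    and x: "x \<in> cball x0 r" and x': "x' \<in> cball x0 r"
  obtains v where "F x' - F x \<le> v" "norm v \<le> C / r * norm (x' - x)"
proof (cases "x = x'")
  case True
  then show ?thesis using that[of 0] by simp
next
  case False
  \<comment> \<open>The scaling gives \<open>w\<close> norm \<open>2 * r\<close>, so
    \<open>x + w\<close> stays in the ball of radius \<open>3 * r\<close>. As \<open>x\<close> and
    \<open>x'\<close> are at most \<open>2 * r\<close> apart, the fraction is at most 1.\<close>
  define \<theta> where "\<theta> = norm (x' - x) / (2 * r)"
  define w where "w = (1 / \<theta>) *\<^sub>R (x' - x)"
  have "norm (x' - x) \<le> 2 * r"
    using x x' dist_triangle2[of x' x x0] by (simp add: dist_norm norm_minus_commute)
  then have \<theta>: "0 < \<theta>" "\<theta> \<le> 1"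
    using False r by (auto simp: \<theta>_def)
  have "norm w = 2 * r"
    using False r by (simp add: w_def \<theta>_def)
  then have "x + w \<in> cball x0 (3 * r)"
    using x norm_triangle_ineq4[of "x0 - x" w] by (simp add: dist_norm algebra_simps)
  moreover have "x \<in> cball x0 (3 * r)"
    using x r by simp
  ultimately have "norm (F (x + w)) \<le> C" "norm (F x) \<le> C"
    using bd by blast+
  then have "norm (F (x + w) - F x) \<le> 2 * C"
    using norm_triangle_ineq4[of "F (x + w)" "F x"] by linarith
  then have "norm (\<theta> *\<^sub>R (F (x + w) - F x)) \<le> \<theta> * (2 * C)"
    using \<theta> by simp
  moreover have "F x' - F x \<le> \<theta> *\<^sub>R (F (x + w) - F x)"
    using convex_op_increment[OF F, of \<theta> x w] \<theta> by (simp add: w_def)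
  moreover have "\<theta> * (2 * C) = C / r * norm (x' - x)"
    using r by (simp add: \<theta>_def field_simps)
  ultimately show ?thesis
    using that by metis
qed

text \<open>Exchanging \<open>x\<close> and \<open>x'\<close> turns the one-sided bound into a
  two-sided one; adding the norms of both bounds produces the factor 2.\<close>

lemma convex_op_lipschitz:
  fixes F :: "'a::banach_lattice \<Rightarrow> 'a"
  assumes F: "convex_op F" and r: "r > 0"
    and bd: "\<And>z. z \<in> cball x0 (3 * r) \<Longrightarrow> norm (F z) \<le> C"
    and x: "x \<in> cball x0 r" and x': "x' \<in> cball x0 r"
  shows "norm (F x' - F x) \<le> 2 * C / r * norm (x' - x)"
proof -
  obtain u v where "F x' - F x \<le> u" "norm u \<le> C / r * norm (x' - x)"
    "F x - F x' \<le> v" "norm v \<le> C / r * norm (x - x')"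
    using convex_op_diff_le[OF F r bd x x'] convex_op_diff_le[OF F r bd x' x] by metis
  moreover from this have "- v \<le> F x' - F x"
    by (metis minus_diff_eq neg_le_iff_le)
  ultimately show ?thesis
    using norm_le_of_order_bounds[of "- v" "F x' - F x" u] by (simp add: norm_minus_commute)
qed

lemma bounded_opE:
  assumes "bounded_op F"
  obtains C where "\<And>x. norm x \<le> r \<Longrightarrow> norm (F x) \<le> C"
proof -
  \<comment> \<open>The maximum with 1 is taken because \<open>bounded_op\<close> speaks of positive
    radii, while \<open>r\<close> is arbitrary here.\<close>
  have "bdd_above {norm (F x) |x. norm x \<le> max 1 r}"
    using assms by (simp add: bounded_op_def)
  then obtain C where "\<And>x. norm x \<le> max 1 r \<Longrightarrow> norm (F x) \<le> C"
    by (auto simp: bdd_above_def)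
  then show ?thesis
    using that by (meson max.coboundedI2)
qed

lemma isCont_convex_bounded_op:
  assumes "convex_op F" "bounded_op F"
  shows "isCont F x"
proof -
  obtain C where C: "\<And>z. norm z \<le> norm x + 3 \<Longrightarrow> norm (F z) \<le> C"
    using bounded_opE[OF assms(2)] by metis
  have "norm (F z) \<le> C" if "z \<in> cball x (3 * 1)" for z
    using that C norm_triangle_ineq2[of z x] by (simp add: dist_norm norm_minus_commute)
  note lip = convex_op_lipschitz[OF assms(1) zero_less_one this]
  have "\<forall>\<^sub>F z in at x. norm (F z - F x) \<le> 2 * C / 1 * norm (z - x)"
    by (rule eventually_at_ball[OF zero_less_one, of x UNIV, THEN eventually_mono])
      (rule lip, auto)
  moreover have "((\<lambda>z. 2 * C / 1 * norm (z - x)) \<longlongrightarrow> 0) (at x)"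
    by (rule tendsto_eq_intros refl | simp)+
  ultimately have "((\<lambda>z. F z - F x) \<longlongrightarrow> 0) (at x)"
    by (rule Lim_null_comparison)
  then show ?thesis
    by (simp add: isCont_def LIM_zero_iff)
qed

subsection \<open>Convex semigroups\<close>

lemma convex_C0_semigroupD:
  assumes "convex_C0_semigroup S"
  shows "t \<ge> 0 \<Longrightarrow> bounded_op (S t)" "t \<ge> 0 \<Longrightarrow> convex_op (S t)" "S 0 x = x"
    "s \<ge> 0 \<Longrightarrow> t \<ge> 0 \<Longrightarrow> S (t + s) x = S t (S s x)"
    "((\<lambda>t. S t x) \<longlongrightarrow> x) (at_right 0)" "t \<ge> 0 \<Longrightarrow> isCont (S t) x"
  using assms isCont_convex_bounded_op[of "S t"]
  by (auto simp: convex_C0_semigroup_def C0_semigroup_def)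

section \<open>Local bounds and Lipschitz constants that are uniform in time\<close>

lemma semigroup_bounded_near_0:
  assumes S: "convex_C0_semigroup S"
  obtains \<delta> where "\<delta> > 0" "\<And>t. 0 \<le> t \<Longrightarrow> t \<le> \<delta> \<Longrightarrow> norm (S t x) \<le> norm x + 1"
proof -
  have "\<forall>\<^sub>F t in at_right 0. dist (S t x) x < 1"
    using convex_C0_semigroupD(5)[OF S] by (rule tendstoD) simp
  then obtain b where b: "b > 0" "\<And>t. 0 < t \<Longrightarrow> t < b \<Longrightarrow> dist (S t x) x < 1"
    by (auto simp: eventually_at_right_field)
  have "norm (S t x) \<le> norm x + 1" if "0 \<le> t" "t \<le> b / 2" for t
  proof (cases "t = 0")
    case False
    then have "norm (S t x - x) < 1"
      using b(2)[of t] that by (simp add: dist_norm b)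
    then show ?thesis
      using norm_triangle_ineq2[of "S t x" x] by simp
  qed (simp add: convex_C0_semigroupD[OF S])
  then show ?thesis
    using b(1) that[of "b / 2"] by simp
qed

text \<open>Baire category: strong continuity at time 0 bounds each single orbit for a short time,
  so the closed sets \<open>E k\<close> cover the space and one of them contains a ball.\<close>

lemma semigroup_uniformly_bounded_on_some_ball:
  assumes S: "convex_C0_semigroup (S :: real \<Rightarrow> 'a::banach_lattice \<Rightarrow> 'a)"
  obtains x1 \<rho> \<delta> C where "\<rho> > 0" "\<delta> > 0"
    "\<And>t x. 0 \<le> t \<Longrightarrow> t \<le> \<delta> \<Longrightarrow> x \<in> cball x1 \<rho> \<Longrightarrow> norm (S t x) \<le> C"
proof -
  \<comment> \<open>One index controls both the bound and the length of time. A larger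
    \<open>k\<close> relaxes both conditions, so the two indices found for a point can be merged by
    taking their maximum.\<close>
  define E where "E k = {x. \<forall>t. 0 \<le> t \<and> t \<le> 1 / real (Suc k) \<longrightarrow> norm (S t x) \<le> real k}" for k
  have "closed (E k)" for k
  proof -
    have "E k = (\<Inter>t\<in>{0..1 / real (Suc k)}. {x. norm (S t x) \<le> real k})"
      by (auto simp: E_def)
    moreover have "closed {x. norm (S t x) \<le> real k}" if "t \<ge> 0" for t
      using convex_C0_semigroupD(6)[OF S that]
      by (intro closed_Collect_le continuous_intros) (simp add: continuous_on_eq_continuous_at)
    ultimately show ?thesis
      by auto
  qed
  moreover have "(\<Union>k. E k) = UNIV"
  proof safe
    fix x
    obtain \<delta> where \<delta>: "\<delta> > 0" "\<And>t. 0 \<le> t \<Longrightarrow> t \<le> \<delta> \<Longrightarrow> norm (S t x) \<le> norm x + 1"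
      using semigroup_bounded_near_0[OF S] by metis
    obtain n where n: "1 / real (Suc n) < \<delta>"
      using \<delta>(1) nat_approx_posE by metis
    obtain m where m: "norm x + 1 \<le> real m"
      using real_arch_simple by blast
    have "1 / real (Suc (max n m)) \<le> \<delta>"
      using n by (smt (verit) frac_le of_nat_0_less_iff of_nat_le_iff max.cobounded1 Suc_le_mono zero_less_Suc)
    then have "x \<in> E (max n m)"
      using \<delta>(2) m by (fastforce simp: E_def)
    then show "x \<in> (\<Union>k. E k)" by blast
  qed simp
  ultimately have "\<exists>k. interior (E k) \<noteq> {}"
    using Met_TC.metric_Baire_category_alt[of "range E"]
    by (force simp: complete_UNIV)
  then obtain k x1 \<rho> where "\<rho> > 0" "cball x1 \<rho> \<subseteq> E k"
    by (metis all_not_in_conv mem_interior_cball)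
  then show ?thesis
    using that[of \<rho> "1 / real (Suc k)" x1 "real k"] by (force simp: E_def)
qed

text \<open>Convexity moves the ball found by Baire category from \<open>x1\<close> to an arbitrary
  centre \<open>x0\<close>. With \<open>x2\<close> the reflection of \<open>x1\<close> in
  \<open>x0\<close>, a point near \<open>x0\<close> is the midpoint of \<open>x2\<close> and a point
  near \<open>x1\<close>, which gives an upper bound. The radius is halved because the second point
  moves twice as fast as \<open>x\<close>.\<close>

lemma semigroup_locally_bounded_near_0:
  assumes S: "convex_C0_semigroup (S :: real \<Rightarrow> 'a::banach_lattice \<Rightarrow> 'a)"
  obtains r \<delta> C where "r > 0" "\<delta> > 0"
    "\<And>t x. 0 \<le> t \<Longrightarrow> t \<le> \<delta> \<Longrightarrow> x \<in> cball x0 r \<Longrightarrow> norm (S t x) \<le> C"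
proof -
  obtain x1 \<rho> \<delta>1 C1 where 1: "\<rho> > 0" "\<delta>1 > 0"
    "\<And>t x. 0 \<le> t \<Longrightarrow> t \<le> \<delta>1 \<Longrightarrow> x \<in> cball x1 \<rho> \<Longrightarrow> norm (S t x) \<le> C1"
    using semigroup_uniformly_bounded_on_some_ball[OF S] by metis
  define x2 where "x2 = 2 *\<^sub>R x0 - x1"
  obtain \<delta>2 where 2: "\<delta>2 > 0" "\<And>t. 0 \<le> t \<Longrightarrow> t \<le> \<delta>2 \<Longrightarrow> norm (S t x2) \<le> norm x2 + 1"
    using semigroup_bounded_near_0[OF S] by metis
  obtain \<delta>0 where 0: "\<delta>0 > 0" "\<And>t. 0 \<le> t \<Longrightarrow> t \<le> \<delta>0 \<Longrightarrow> norm (S t x0) \<le> norm x0 + 1"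
    using semigroup_bounded_near_0[OF S] by metis
  define \<delta> where "\<delta> = min \<delta>0 (min \<delta>1 \<delta>2)"
  define D where "D = (C1 + norm x2 + 1) / 2"
  have upper: "\<exists>v. S t x \<le> v \<and> norm v \<le> D" if t: "0 \<le> t" "t \<le> \<delta>" and x: "x \<in> cball x0 (\<rho> / 2)" for t x
  proof -
    have "2 *\<^sub>R x - x2 - x1 = 2 *\<^sub>R (x - x0)"
      by (simp add: x2_def algebra_simps)
    then have "norm (2 *\<^sub>R x - x2 - x1) \<le> \<rho>"
      using x by (simp add: dist_norm norm_minus_commute)
    then have b: "norm (S t (2 *\<^sub>R x - x2)) \<le> C1"
      using 1(3) t by (simp add: \<delta>_def dist_norm norm_minus_commute)
    have "x = (1/2) *\<^sub>R (2 *\<^sub>R x - x2) + (1 - 1/2) *\<^sub>R x2"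
      by (simp add: algebra_simps)
    then have "S t x \<le> (1/2) *\<^sub>R S t (2 *\<^sub>R x - x2) + (1 - 1/2) *\<^sub>R S t x2"
      using convex_opD[OF convex_C0_semigroupD(2)[OF S], of t "1/2" "2 *\<^sub>R x - x2" x2] t by simp
    moreover have "norm ((1/2) *\<^sub>R S t (2 *\<^sub>R x - x2) + (1 - 1/2) *\<^sub>R S t x2) \<le> D"
      using b 2(2)[of t] t norm_triangle_ineq[of "(1/2) *\<^sub>R S t (2 *\<^sub>R x - x2)" "(1 - 1/2) *\<^sub>R S t x2"]
      by (simp add: \<delta>_def D_def field_simps)
    ultimately show ?thesis by blast
  qed
  have "norm (S t x) \<le> 2 * (norm x0 + 1) + 2 * D"
    if t: "0 \<le> t" "t \<le> \<delta>" and x: "x \<in> cball x0 (\<rho> / 2)" for t x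
  proof -
    \<comment> \<open>For the lower bound, \<open>x0\<close> is the midpoint of \<open>x\<close> and
      its reflection. Convexity bounds \<open>S t x\<close> from below by \<open>2 S t x0\<close>
      minus the value at the reflection, to which the upper bound applies.\<close>
    have "2 *\<^sub>R x0 - x \<in> cball x0 (\<rho> / 2)"
      using x by (simp add: dist_norm norm_minus_commute scaleR_2)
    then obtain u v where uv: "S t x \<le> u" "norm u \<le> D" "S t (2 *\<^sub>R x0 - x) \<le> v" "norm v \<le> D"
      using upper[OF t x] upper[OF t, of "2 *\<^sub>R x0 - x"] by blast
    have "x0 = (1/2) *\<^sub>R x + (1 - 1/2) *\<^sub>R (2 *\<^sub>R x0 - x)"
      by (simp add: algebra_simps)
    then have "S t x0 \<le> (1/2) *\<^sub>R S t x + (1 - 1/2) *\<^sub>R S t (2 *\<^sub>R x0 - x)"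
      using convex_opD[OF convex_C0_semigroupD(2)[OF S], of t "1/2" x "2 *\<^sub>R x0 - x"] t by simp
    then have "2 *\<^sub>R S t x0 \<le> 2 *\<^sub>R ((1/2) *\<^sub>R S t x + (1 - 1/2) *\<^sub>R S t (2 *\<^sub>R x0 - x))"
      by (rule scaleR_left_mono) simp
    then have "2 *\<^sub>R S t x0 \<le> S t x + S t (2 *\<^sub>R x0 - x)"
      by (simp add: algebra_simps)
    then have "2 *\<^sub>R S t x0 - v \<le> S t x"
      using uv(3) by (smt (verit) add_left_mono diff_le_eq order_trans)
    then have "norm (S t x) \<le> norm (2 *\<^sub>R S t x0 - v) + norm u"
      using uv(1) by (rule norm_le_of_order_bounds)
    also have "norm (2 *\<^sub>R S t x0 - v) \<le> 2 * (norm x0 + 1) + D"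
      using uv 0(2)[of t] t norm_triangle_ineq4[of "2 *\<^sub>R S t x0" v] by (simp add: \<delta>_def)
    finally show ?thesis
      using uv by simp
  qed
  then show ?thesis
    using that[of "\<rho> / 2" \<delta>] 0 1 2 by (auto simp: \<delta>_def)
qed

text \<open>Orbits starting in a small ball stay bounded on \<open>[0, \<delta>]\<close>, and each operator \<open>S (n \<delta>)\<close> is bounded on balls,
  so the local bound propagates to \<open>[n \<delta>, (n + 1) \<delta>]\<close>.\<close>

lemma semigroup_locally_bounded:
  assumes S: "convex_C0_semigroup (S :: real \<Rightarrow> 'a::banach_lattice \<Rightarrow> 'a)"
  obtains r C where "r > 0"
    "\<And>t x. 0 \<le> t \<Longrightarrow> t \<le> R \<Longrightarrow> x \<in> cball x0 r \<Longrightarrow> norm (S t x) \<le> C"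
proof -
  obtain r \<delta> C where 0: "r > 0" "\<delta> > 0"
    "\<And>t x. 0 \<le> t \<Longrightarrow> t \<le> \<delta> \<Longrightarrow> x \<in> cball x0 r \<Longrightarrow> norm (S t x) \<le> C"
    using semigroup_locally_bounded_near_0[OF S] by metis
  have step: "\<exists>C'. \<forall>t x. 0 \<le> t \<and> t \<le> real n * \<delta> \<and> x \<in> cball x0 r \<longrightarrow> norm (S t x) \<le> C'" for n
  proof (induction n)
    case 0
    have "norm x \<le> norm x0 + r" if "x \<in> cball x0 r" for x
      using that norm_triangle_ineq2[of x x0] by (simp add: dist_norm norm_minus_commute)
    moreover have "t = 0" if "0 \<le> t" "t \<le> real 0 * \<delta>" for t
      using that by simp
    ultimately show ?case
      using convex_C0_semigroupD(3)[OF S] by metis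
  next
    case (Suc n)
    then obtain C1 where C1: "\<And>t x. 0 \<le> t \<Longrightarrow> t \<le> real n * \<delta> \<Longrightarrow> x \<in> cball x0 r \<Longrightarrow> norm (S t x) \<le> C1"
      by blast
    have "bounded_op (S (real n * \<delta>))"
      using 0 convex_C0_semigroupD(1)[OF S] by simp
    then obtain C2 where C2: "\<And>y. norm y \<le> C \<Longrightarrow> norm (S (real n * \<delta>) y) \<le> C2"
      using bounded_opE by metis
    have "norm (S t x) \<le> max C1 C2" if t: "0 \<le> t" "t \<le> real (Suc n) * \<delta>" and x: "x \<in> cball x0 r" for t x
    proof (cases "t \<le> real n * \<delta>")
      case False
      then have "S t x = S (real n * \<delta>) (S (t - real n * \<delta>) x)"
        using convex_C0_semigroupD(4)[OF S, of "t - real n * \<delta>" "real n * \<delta>" x] 0 by simp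
      moreover have "norm (S (t - real n * \<delta>) x) \<le> C"
        using 0(3) False t x by (simp add: algebra_simps)
      ultimately show ?thesis
        using C2 by (simp add: max.coboundedI2)
    qed (use C1 t x in \<open>simp add: max.coboundedI1\<close>)
    then show ?case by blast
  qed
  obtain n where "R / \<delta> \<le> real n"
    using real_arch_simple by blast
  then have "R \<le> real n * \<delta>"
    using 0 by (simp add: field_simps)
  then show ?thesis
    using step[of n] that[OF 0(1)] by (meson order_trans)
qed

lemma semigroup_locally_lipschitz:
  assumes S: "convex_C0_semigroup (S :: real \<Rightarrow> 'a::banach_lattice \<Rightarrow> 'a)"
  obtains r L where "r > 0" "L \<ge> 0"
    "\<And>t x y. 0 \<le> t \<Longrightarrow> t \<le> R \<Longrightarrow> x \<in> cball x0 r \<Longrightarrow> y \<in> cball x0 r \<Longrightarrow>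
      norm (S t x - S t y) \<le> L * norm (x - y)"
proof -
  obtain r C where rC: "r > 0"
    "\<And>t x. 0 \<le> t \<Longrightarrow> t \<le> R \<Longrightarrow> x \<in> cball x0 r \<Longrightarrow> norm (S t x) \<le> C"
    using semigroup_locally_bounded[OF S] by metis
  have *: "norm (S t x - S t y) \<le> 2 * C / (r / 3) * norm (x - y)"
    if t: "0 \<le> t" "t \<le> R" and xy: "x \<in> cball x0 (r / 3)" "y \<in> cball x0 (r / 3)" for t x y
  proof (rule convex_op_lipschitz[OF _ _ _ xy(2,1)])
    show "convex_op (S t)"
      using convex_C0_semigroupD(2)[OF S t(1)] .
  qed (use rC t in auto)
  \<comment> \<open>If \<open>R\<close> is negative, \<open>C\<close> is arbitrary and may be
    negative; the maximum with 0 makes the constant nonnegative in every case.\<close>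
  have "norm (S t x - S t y) \<le> max 0 (2 * C / (r / 3)) * norm (x - y)"
    if "0 \<le> t" "t \<le> R" "x \<in> cball x0 (r / 3)" "y \<in> cball x0 (r / 3)" for t x y
    using *[OF that] by (rule order_trans) (intro mult_right_mono; simp)
  then show ?thesis
    using that[of "r / 3" "max 0 (2 * C / (r / 3))"] rC(1) by simp
qed

lemma semigroup_tendsto_locally_uniform:
  assumes S: "convex_C0_semigroup (S :: real \<Rightarrow> 'a::banach_lattice \<Rightarrow> 'a)"
    and R: "\<And>n. 0 \<le> r n" "\<And>n. r n \<le> R"
    and x: "x \<longlonglongrightarrow> p" and y: "y \<longlonglongrightarrow> p"
  shows "(\<lambda>n. S (r n) (x n) - S (r n) (y n)) \<longlonglongrightarrow> 0"
proof -
  obtain \<rho> L where L: "\<rho> > 0" "\<And>t x y. 0 \<le> t \<Longrightarrow> t \<le> R \<Longrightarrow> x \<in> cball p \<rho> \<Longrightarrow> y \<in> cball p \<rho> \<Longrightarrow>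
      norm (S t x - S t y) \<le> L * norm (x - y)"
    using semigroup_locally_lipschitz[OF S] by metis
  have ev: "\<forall>\<^sub>F n in sequentially. z n \<in> cball p \<rho>" if "z \<longlonglongrightarrow> p" for z
    using tendstoD[OF that L(1)] by eventually_elim (simp add: dist_commute)
  have "\<forall>\<^sub>F n in sequentially. norm (S (r n) (x n) - S (r n) (y n)) \<le> L * norm (x n - y n)"
    using ev[OF x] ev[OF y] by eventually_elim (use L(2) R in auto)
  moreover have "(\<lambda>n. L * norm (x n - y n)) \<longlonglongrightarrow> 0"
    using tendsto_mult_right_zero[OF tendsto_norm_zero[OF LIM_zero]] tendsto_diff[OF x y]
    by (simp add: tendsto_mult_right_zero tendsto_norm_zero)
  ultimately show ?thesis
    by (rule Lim_null_comparison)
qed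

text \<open>Continuity in time at \<open>t\<close> is reduced to continuity at 0:
  \<open>S (r n) p\<close> and \<open>S t p\<close> are both images under
  \<open>S (min (r n) t)\<close> of points tending to \<open>p\<close>. The Lipschitz constant,
  uniform in time, handles the moving outer operator and also the passage from \<open>x n\<close> to
  \<open>p\<close>.\<close>

lemma semigroup_jointly_continuous:
  assumes S: "convex_C0_semigroup (S :: real \<Rightarrow> 'a::banach_lattice \<Rightarrow> 'a)"
  shows "continuous_on ({0..} \<times> UNIV) (\<lambda>(t, x). S t x)"
proof (rule continuous_on_sequentiallyI)
  fix u :: "nat \<Rightarrow> real \<times> 'a" and a
  assume u: "\<forall>n. u n \<in> {0..} \<times> UNIV" "a \<in> {0..} \<times> UNIV" "u \<longlonglongrightarrow> a"
  define r where "r n = fst (u n)" for n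
  define x where "x n = snd (u n)" for n
  obtain t p where a: "a = (t, p)" by fastforce
  have t: "t \<ge> 0" and r0: "\<And>n. 0 \<le> r n"
    using u a by (auto simp: r_def mem_Times_iff)
  have r: "r \<longlonglongrightarrow> t" and x: "x \<longlonglongrightarrow> p"
    using tendsto_fst[OF u(3)] tendsto_snd[OF u(3)] by (simp_all add: r_def[abs_def] x_def[abs_def] a)
  obtain R where "\<And>n. r n \<le> R"
    using r Bseq_def convergent_imp_Bseq[of r] by (metis abs_le_D1 convergentI real_norm_def)
  then have R: "\<And>n. min (r n) t \<le> max R t" "\<And>n. r n \<le> max R t"
    by (simp_all add: le_max_iff_disj)
  have m: "min (r n) t \<ge> 0" for n
    using t r0 by simp
  have S0: "(\<lambda>n. S (c n) p) \<longlonglongrightarrow> p" if "c \<longlonglongrightarrow> 0" "\<And>n. 0 \<le> c n" for c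
  proof -
    \<comment> \<open>The remaining times may equal 0 for some \<open>n\<close>, so the limit from
      the right is upgraded to continuity within the closed half-line, using
      \<open>S 0 p = p\<close>.\<close>
    have "{0..} - {0} = {0<..} - {0 :: real}"
      by auto
    then have "((\<lambda>t. S t p) \<longlongrightarrow> p) (at 0 within {0..})"
      using convex_C0_semigroupD(5)[OF S, of p] 
      by (simp add: at_within_def del: Diff_empty)
    then have "continuous (at 0 within {0..}) (\<lambda>t. S t p)"
      by (simp add: continuous_within convex_C0_semigroupD(3)[OF S])
    then show ?thesis
      using that continuous_within_tendsto_compose'[of 0 "{0..}" "\<lambda>t. S t p" c sequentially]
      by (simp add: convex_C0_semigroupD(3)[OF S])
  qed
  have c1: "(\<lambda>n. r n - min (r n) t) \<longlonglongrightarrow> 0" and c2: "(\<lambda>n. t - min (r n) t) \<longlonglongrightarrow> 0"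
    by (rule tendsto_eq_intros r refl | simp)+
  have "(\<lambda>n. S (min (r n) t) (S (r n - min (r n) t) p) - S (min (r n) t) (S (t - min (r n) t) p)) \<longlonglongrightarrow> 0"
    by (rule semigroup_tendsto_locally_uniform[OF S m R(1) S0[OF c1] S0[OF c2]]) auto
  moreover have "S (min (r n) t) (S (r n - min (r n) t) p) = S (r n) p"
    "S (min (r n) t) (S (t - min (r n) t) p) = S t p" for n
    using m convex_C0_semigroupD(4)[OF S, of _ "min (r n) t" p, symmetric] by simp_all
  ultimately have "(\<lambda>n. S (r n) p - S t p) \<longlonglongrightarrow> 0"
    by simp
  moreover have "(\<lambda>n. S (r n) (x n) - S (r n) p) \<longlonglongrightarrow> 0"
    by (rule semigroup_tendsto_locally_uniform[OF S r0 R(2) x tendsto_const])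
  ultimately have "(\<lambda>n. (S (r n) p - S t p) + (S (r n) (x n) - S (r n) p)) \<longlonglongrightarrow> 0"
    using tendsto_add[of _ 0 _ _ 0] by fastforce
  then have "(\<lambda>n. S (r n) (x n) - S t p) \<longlonglongrightarrow> 0"
    by simp
  then show "(\<lambda>n. (case u n of (t, x) \<Rightarrow> S t x)) \<longlonglongrightarrow> (case a of (t, x) \<Rightarrow> S t x)"
    unfolding LIM_zero_iff by (simp add: r_def x_def a case_prod_beta')
qed

subsection \<open>Decreasing sequences and the functionals in M\<close>

lemma riesz_embedding_le_iff:
  assumes "riesz_embedding \<iota>"
  shows "\<iota> x \<le> \<iota> y \<longleftrightarrow> x \<le> y"
  using assms unfolding riesz_embedding_def by (metis inj_eq le_iff_sup)

lemma decr_toD: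
  assumes "riesz_embedding \<iota>" "decr_to \<iota> (\<lambda>n. \<iota> (x n)) y"
  shows "decseq x" "y \<le> \<iota> (x n)" "\<exists>z. \<forall>n. z \<le> x n"
    "(\<And>n. z \<le> \<iota> (x n)) \<Longrightarrow> z \<le> y"
  using assms
  by (auto simp: decr_to_def is_glb_def decseq_def riesz_embedding_le_iff)

lemma decr_toI:
  assumes "riesz_embedding \<iota>" "decseq x" "\<And>n. z \<le> x n"
    "\<And>n. y \<le> \<iota> (x n)" "\<And>z. (\<And>n. z \<le> \<iota> (x n)) \<Longrightarrow> z \<le> y"
  shows "decr_to \<iota> (\<lambda>n. \<iota> (x n)) y"
  using assms
  by (auto simp: decr_to_def is_glb_def decseq_def riesz_embedding_le_iff)

lemma decr_to_const:
  assumes "riesz_embedding \<iota>"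
  shows "decr_to \<iota> (\<lambda>n. \<iota> x) (\<iota> x)"
  by (rule decr_toI[OF assms]) auto

lemma embedding_in_X_delta:
  assumes "riesz_embedding \<iota>"
  shows "\<iota> x \<in> X_delta \<iota>"
  using decr_to_const[OF assms] by (force simp: X_delta_def)

lemma decr_to_affine:
  assumes \<iota>: "riesz_embedding \<iota>" and x: "decr_to \<iota> (\<lambda>n. \<iota> (x n)) (\<iota> p)" and c: "c > 0"
  shows "decr_to \<iota> (\<lambda>n. \<iota> (v + c *\<^sub>R x n)) (\<iota> (v + c *\<^sub>R p))"
proof -
  note lin = linear_add linear_cmul
  have \<iota>_lin: "\<iota> (v + c *\<^sub>R w) = \<iota> v + c *\<^sub>R \<iota> w" for w
    using \<iota> by (simp add: riesz_embedding_def lin)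
  obtain z where z: "\<And>n. z \<le> x n"
    using decr_toD(3)[OF \<iota> x] by blast
  show ?thesis
  proof (rule decr_toI[OF \<iota>])
    show "decseq (\<lambda>n. v + c *\<^sub>R x n)"
      using decr_toD(1)[OF \<iota> x] c by (auto simp: decseq_def intro!: scaleR_left_mono)
    show "v + c *\<^sub>R z \<le> v + c *\<^sub>R x n" for n
      using z c by (simp add: scaleR_left_mono)
    show "\<iota> (v + c *\<^sub>R p) \<le> \<iota> (v + c *\<^sub>R x n)" for n
      using decr_toD(2)[OF \<iota> x] c by (simp add: \<iota>_lin scaleR_left_mono)
    fix w assume w: "\<And>n. w \<le> \<iota> (v + c *\<^sub>R x n)"
    have "(w - \<iota> v) /\<^sub>R c \<le> \<iota> (x n)" for n
      using w[of n] c by (simp add: \<iota>_lin pos_divideR_le_eq diff_le_eq add.commute)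
    then have "(w - \<iota> v) /\<^sub>R c \<le> \<iota> p"
      by (rule decr_toD(4)[OF \<iota> x])
    then show "w \<le> \<iota> (v + c *\<^sub>R p)"
      using c by (simp add: \<iota>_lin pos_divideR_le_eq diff_le_eq add.commute)
  qed
qed

text \<open>The limit \<open>z\<close> may lie outside X, where continuity from above cannot be
  applied directly. Taking suprema with an element of X above \<open>z\<close> replaces the sequence
  by one whose limit is in X.\<close>

lemma decr_to_sup:
  assumes \<iota>: "riesz_embedding \<iota>" and a: "decr_to \<iota> (\<lambda>n. \<iota> (a n)) z" and q: "z \<le> \<iota> q"
  shows "decr_to \<iota> (\<lambda>n. \<iota> (sup (a n) q)) (\<iota> q)"
proof (rule decr_toI[OF \<iota>])
  have \<iota>_sup: "\<iota> (sup (a n) q) = sup (\<iota> (a n)) (\<iota> q)" for n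
    using \<iota> by (simp add: riesz_embedding_def)
  show "decseq (\<lambda>n. sup (a n) q)"
    using decr_toD(1)[OF \<iota> a] by (auto simp: decseq_def intro: le_supI1)
  show "q \<le> sup (a n) q" for n by simp
  show "\<iota> q \<le> \<iota> (sup (a n) q)" for n by (simp add: \<iota>_sup)
  fix w assume w: "\<And>n. w \<le> \<iota> (sup (a n) q)"
  \<comment> \<open>Adding the bounds on supremum and infimum and using that their sum is the sum of
    the two elements transfers the lower bound \<open>w\<close> to the original sequence.\<close>
  have "w - \<iota> q + z \<le> \<iota> (a n)" for n
  proof -
    have "z \<le> inf (\<iota> (a n)) (\<iota> q)"
      using decr_toD(2)[OF \<iota> a] q by simp
    then have "w + z \<le> sup (\<iota> (a n)) (\<iota> q) + inf (\<iota> (a n)) (\<iota> q)"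
      using w[of n] by (simp add: \<iota>_sup add_mono)
    then have "w + z \<le> \<iota> (a n) + \<iota> q"
      by (simp flip: add_eq_inf_sup)
    then show ?thesis
      by (simp add: algebra_simps)
  qed
  then have "w - \<iota> q + z \<le> z"
    by (rule decr_toD(4)[OF \<iota> a])
  then show "w \<le> \<iota> q"
    by (simp add: algebra_simps)
qed

text \<open>The negative part of \<open>l\<close> is dominated by \<open>|x n - l|\<close>, hence
  its norm is 0.\<close>

lemma tendsto_nonneg_banach_lattice:
  fixes x :: "nat \<Rightarrow> 'a::banach_lattice"
  assumes x: "\<forall>\<^sub>F n in sequentially. 0 \<le> x n" and l: "x \<longlonglongrightarrow> l"
  shows "0 \<le> l"
proof -
  have "norm (sup (- l) 0) \<le> norm (x n - l)" if "0 \<le> x n" for n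
  proof -
    have "- l \<le> x n - l"
      using that by simp
    then have "sup (- l) 0 \<le> \<bar>x n - l\<bar>"
      by (intro le_supI) (auto intro: order_trans[OF _ abs_ge_self])
    then show ?thesis
      by (intro lattice_norm) simp
  qed
  then have "\<forall>\<^sub>F n in sequentially. norm (sup (- l) 0) \<le> norm (x n - l)"
    using x by (rule eventually_mono[rotated])
  moreover have "(\<lambda>n. norm (x n - l)) \<longlonglongrightarrow> 0"
    using l LIM_zero tendsto_norm_zero by blast
  ultimately have "norm (sup (- l) 0) \<le> 0"
    using tendsto_lowerbound by fastforce
  then have "sup (- l) 0 = 0"
    by simp
  then have "- l \<le> 0"
    by (metis sup_ge1)
  then show ?thesis by simp
qed

text \<open>Otherwise there are positive \<open>x n\<close> in the unit ball with values above
  \<open>4 ^ n\<close>. The sum of the vectors \<open>(1/2) ^ n x n\<close> converges and dominates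
  each term, so its value would exceed every \<open>2 ^ n\<close>. A bound on the positive part of
  the ball suffices since the modulus of \<open>x\<close> dominates both \<open>x\<close> and
  \<open>- x\<close>.\<close>

lemma positive_functional_bounded_linear:
  fixes \<mu> :: "'a::banach_lattice \<Rightarrow> real"
  assumes lin: "linear \<mu>" and pos: "\<And>x. 0 \<le> x \<Longrightarrow> 0 \<le> \<mu> x"
  shows "bounded_linear \<mu>"
proof -
  have mono: "\<mu> x \<le> \<mu> y" if "x \<le> y" for x y
    using pos[of "y - x"] that by (simp add: linear_diff[OF lin])
  have "\<exists>K. \<forall>x. 0 \<le> x \<and> norm x \<le> 1 \<longrightarrow> \<mu> x \<le> K"
  proof (rule ccontr)
    assume "\<not> ?thesis"
    then have "\<exists>x. 0 \<le> x \<and> norm x \<le> 1 \<and> 4 ^ n < \<mu> x" for n :: nat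
      by (meson not_le)
    then obtain x where x: "\<And>n. 0 \<le> x n" "\<And>n. norm (x n) \<le> 1" "\<And>n::nat. 4 ^ n < \<mu> (x n)"
      by metis
    define f where "f n = (1/2) ^ n *\<^sub>R x n" for n
    have "norm (f n) \<le> (1/2) ^ n" for n
      using x(2)[of n] by (simp add: f_def)
    then have f: "summable f"
      by (intro summable_comparison_test'[OF summable_geometric, of "1/2" 0 f]) auto
    have f0: "0 \<le> f n" for n
      using x(1) by (simp add: f_def scaleR_nonneg_nonneg)
    have "f n \<le> suminf f" for n
    proof -
      have "f n \<le> (\<Sum>i<m. f i)" if "m \<ge> Suc n" for m
        using that f0 sum_mono2[of "{..<m}" "{n}" f] by simp
      then have "\<forall>\<^sub>F m in sequentially. 0 \<le> (\<Sum>i<m. f i) - f n"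
        by (auto simp: eventually_sequentially)
      moreover have "(\<lambda>m. (\<Sum>i<m. f i) - f n) \<longlonglongrightarrow> suminf f - f n"
        by (intro tendsto_intros summable_LIMSEQ f)
      ultimately show ?thesis
        using tendsto_nonneg_banach_lattice by fastforce
    qed
    then have "\<mu> (f n) \<le> \<mu> (suminf f)" for n
      by (rule mono)
    moreover have "2 ^ n < \<mu> (f n)" for n
    proof -
      have "2 ^ n = (1/2) ^ n * (4::real) ^ n"
        by (simp flip: power_mult_distrib)
      also have "\<dots> < (1/2) ^ n * \<mu> (x n)"
        using x(3) by simp
      finally show ?thesis
        by (simp add: f_def linear_cmul[OF lin])
    qed
    ultimately have "(2::real) ^ n < \<mu> (suminf f)" for n
      by (meson less_le_trans)
    then show False
      using real_arch_pow[of 2 "\<mu> (suminf f)"] by (meson less_asym one_less_numeral_iff semiring_norm(76))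
  qed
  then obtain K where K: "\<And>x. 0 \<le> x \<Longrightarrow> norm x \<le> 1 \<Longrightarrow> \<mu> x \<le> K"
    by blast
  have "norm (\<mu> x) \<le> norm x * K" for x
  proof (cases "x = 0")
    case False
    have "\<mu> (\<bar>x\<bar> /\<^sub>R norm x) \<le> K"
      by (rule K) (use False in \<open>auto intro: scaleR_nonneg_nonneg\<close>)
    then have "\<mu> \<bar>x\<bar> \<le> norm x * K"
      using False by (simp add: linear_cmul[OF lin] field_simps)
    moreover have "\<mu> x \<le> \<mu> \<bar>x\<bar>" "- \<mu> x \<le> \<mu> \<bar>x\<bar>"
      using mono[OF abs_ge_self[of x]] mono[OF abs_ge_minus_self[of x]] by (simp_all add: linear_neg[OF lin])
    ultimately show ?thesis
      by simp
  qed (simp add: linear_0[OF lin])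
  then show ?thesis
    by (intro bounded_linear_intro[of \<mu> K] linear_add[OF lin] linear_cmul[OF lin])
qed

lemma M_functionalsD:
  fixes \<iota> :: "'a::banach_lattice \<Rightarrow> 'b::riesz_space"
  assumes "\<mu> \<in> M_functionals \<iota>"
  shows "bounded_linear \<mu>" "linear \<mu>" "x \<le> y \<Longrightarrow> \<mu> x \<le> \<mu> y"
    "decr_to \<iota> (\<lambda>n. \<iota> (u n)) 0 \<Longrightarrow> (\<lambda>n. \<mu> (u n)) \<longlonglongrightarrow> 0"
proof -
  show lin: "linear \<mu>"
    using assms by (simp add: M_functionals_def)
  have pos: "0 \<le> x \<Longrightarrow> 0 \<le> \<mu> x" for x
    using assms by (simp add: M_functionals_def)
  show "bounded_linear \<mu>"
    using lin pos by (rule positive_functional_bounded_linear)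
  show "x \<le> y \<Longrightarrow> \<mu> x \<le> \<mu> y"
    using pos[of "y - x"] by (simp add: linear_diff[OF lin])
  show "decr_to \<iota> (\<lambda>n. \<iota> (u n)) 0 \<Longrightarrow> (\<lambda>n. \<mu> (u n)) \<longlonglongrightarrow> 0"
    using assms by (simp add: M_functionals_def real_decr_to_def)
qed

lemma M_functional_tendsto:
  fixes \<iota> :: "'a::banach_lattice \<Rightarrow> 'b::riesz_space"
  assumes \<iota>: "riesz_embedding \<iota>" and \<mu>: "\<mu> \<in> M_functionals \<iota>"
    and x: "decr_to \<iota> (\<lambda>n. \<iota> (x n)) (\<iota> p)"
  shows "(\<lambda>n. \<mu> (x n)) \<longlonglongrightarrow> \<mu> p"
proof -
  have "\<iota> 0 = 0"
    using \<iota> by (simp add: riesz_embedding_def linear_0)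
  then have "decr_to \<iota> (\<lambda>n. \<iota> (- p + 1 *\<^sub>R x n)) 0"
    using decr_to_affine[OF \<iota> x, of 1 "- p"] by simp
  then have "(\<lambda>n. \<mu> (- p + 1 *\<^sub>R x n)) \<longlonglongrightarrow> 0"
    by (rule M_functionalsD(4)[OF \<mu>])
  then have "(\<lambda>n. \<mu> (x n) - \<mu> p) \<longlonglongrightarrow> 0"
    by (simp add: linear_diff[OF M_functionalsD(2)[OF \<mu>]])
  then show ?thesis
    by (simp add: LIM_zero_iff)
qed

subsection \<open>Convex operators that are continuous from above\<close>

text \<open>Continuity from above is only assumed at 0; convexity transports it to every point, writing
  \<open>p + d = (1 - c) (p / (1 - c)) + c (d / c)\<close> with small \<open>c\<close>.\<close>

lemma convex_op_continuous_from_above: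
  fixes \<iota> :: "'a::banach_lattice \<Rightarrow> 'b::riesz_space"
  assumes \<iota>: "riesz_embedding \<iota>" and \<mu>: "\<mu> \<in> M_functionals \<iota>"
    and F: "convex_op F" "mono F" "\<And>x. isCont F x"
    and cfa: "\<And>x. decr_to \<iota> (\<lambda>n. \<iota> (x n)) 0 \<Longrightarrow> decr_to \<iota> (\<lambda>n. \<iota> (F (x n))) (\<iota> (F 0))"
    and x: "decr_to \<iota> (\<lambda>n. \<iota> (x n)) (\<iota> p)"
  shows "(\<lambda>n. \<mu> (F (x n))) \<longlonglongrightarrow> \<mu> (F p)"
proof (rule order_tendstoI)
  note \<mu>_lin = linear_add[OF M_functionalsD(2)[OF \<mu>]] linear_cmul[OF M_functionalsD(2)[OF \<mu>]]
  have "p \<le> x n" for n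
    using decr_toD(2)[OF \<iota> x] riesz_embedding_le_iff[OF \<iota>] by blast
  then have "\<mu> (F p) \<le> \<mu> (F (x n))" for n
    using F(2) by (intro M_functionalsD(3)[OF \<mu>]) (simp add: monoD)
  then show "\<forall>\<^sub>F n in sequentially. e < \<mu> (F (x n))" if "e < \<mu> (F p)" for e
    using that by (simp add: less_le_trans)
  fix e assume e: "\<mu> (F p) < e"
  have cont_\<mu>: "isCont \<mu> y" for y
    using M_functionalsD(1)[OF \<mu>] by (rule linear_continuous_at)
  \<comment> \<open>By norm continuity of \<open>F\<close> the bound tends to
    \<open>\<mu> (F p)\<close> as \<open>c\<close> tends to 0. So \<open>c\<close> is fixed first,
    and only then does \<open>n\<close> tend to infinity.\<close>
  have "((\<lambda>c. (1 - c) * \<mu> (F (p /\<^sub>R (1 - c))) + c * \<mu> (F 0))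
      \<longlongrightarrow> (1 - 0) * \<mu> (F (p /\<^sub>R (1 - 0))) + 0 * \<mu> (F 0)) (at_right 0)"
    by (intro tendsto_intros isCont_tendsto_compose[OF cont_\<mu>] isCont_tendsto_compose[OF F(3)]) auto
  then have "((\<lambda>c. (1 - c) * \<mu> (F (p /\<^sub>R (1 - c))) + c * \<mu> (F 0)) \<longlongrightarrow> \<mu> (F p)) (at_right 0)"
    by simp
  then have "\<forall>\<^sub>F c in at_right 0. (1 - c) * \<mu> (F (p /\<^sub>R (1 - c))) + c * \<mu> (F 0) < e"
    using e by (rule order_tendstoD)
  then obtain b where b: "b > 0"
    "\<And>c. 0 < c \<Longrightarrow> c < b \<Longrightarrow> (1 - c) * \<mu> (F (p /\<^sub>R (1 - c))) + c * \<mu> (F 0) < e"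
    by (auto simp: eventually_at_right_field)
  define c where "c = min (b / 2) (1 / 2)"
  have c: "0 < c" "c < 1" and ce: "(1 - c) * \<mu> (F (p /\<^sub>R (1 - c))) + c * \<mu> (F 0) < e"
    using b by (auto simp: c_def)
  define d where "d n = (x n - p) /\<^sub>R c" for n
  have "\<iota> 0 = 0"
    using \<iota> by (simp add: riesz_embedding_def linear_0)
  moreover have "d = (\<lambda>n. - (p /\<^sub>R c) + inverse c *\<^sub>R x n)"
    by (simp add: d_def[abs_def] algebra_simps)
  ultimately have "decr_to \<iota> (\<lambda>n. \<iota> (d n)) 0"
    using decr_to_affine[OF \<iota> x, of "inverse c" "- (p /\<^sub>R c)"] c by simp
  from M_functional_tendsto[OF \<iota> \<mu> cfa[OF this]]
  have "(\<lambda>n. (1 - c) * \<mu> (F (p /\<^sub>R (1 - c))) + c * \<mu> (F (d n)))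
      \<longlonglongrightarrow> (1 - c) * \<mu> (F (p /\<^sub>R (1 - c))) + c * \<mu> (F 0)"
    by (intro tendsto_intros)
  then have "\<forall>\<^sub>F n in sequentially. (1 - c) * \<mu> (F (p /\<^sub>R (1 - c))) + c * \<mu> (F (d n)) < e"
    using ce by (rule order_tendstoD)
  moreover have "\<mu> (F (x n)) \<le> (1 - c) * \<mu> (F (p /\<^sub>R (1 - c))) + c * \<mu> (F (d n))" for n
  proof -
    have "c *\<^sub>R d n + (1 - c) *\<^sub>R (p /\<^sub>R (1 - c)) = x n"
      using c by (simp add: d_def)
    then have "F (x n) \<le> c *\<^sub>R F (d n) + (1 - c) *\<^sub>R F (p /\<^sub>R (1 - c))"
      using convex_opD[OF F(1), of c "d n" "p /\<^sub>R (1 - c)"] c by simp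
    from M_functionalsD(3)[OF \<mu> this] show ?thesis
      by (simp add: \<mu>_lin)
  qed
  ultimately show "\<forall>\<^sub>F n in sequentially. \<mu> (F (x n)) < e"
    by (auto elim!: eventually_mono intro: le_less_trans)
qed

text \<open>The point \<open>y\<close> lies on the segment from \<open>y - v\<close> to
  \<open>y + h v\<close>. The resulting bound is free of \<open>h\<close>, so decreasing families of
  quotients are bounded below.\<close>

lemma convex_op_quotient_lower_bound:
  assumes F: "convex_op F" and h: "h > 0"
  shows "F y - F (y - v) \<le> (F (y + h *\<^sub>R v) - F y) /\<^sub>R h"
proof -
  \<comment> \<open>This is the weight of \<open>y - v\<close> when \<open>y\<close> is written as a
    convex combination of \<open>y - v\<close> and \<open>y + h v\<close>.\<close>
  define c where "c = h / (1 + h)"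
  have c: "0 \<le> c" "c \<le> 1" "c * (1 + h) = h"
    using h by (auto simp: c_def field_simps)
  have "(1 + h) *\<^sub>R (F y - F (y + h *\<^sub>R v)) \<le> (1 + h) *\<^sub>R (c *\<^sub>R (F (y - v) - F (y + h *\<^sub>R v)))"
  proof (intro scaleR_left_mono)
    have "y + h *\<^sub>R v + c *\<^sub>R (- (1 + h) *\<^sub>R v) = y"
    proof -
      have "c *\<^sub>R (- (1 + h) *\<^sub>R v) = - ((c * (1 + h)) *\<^sub>R v)"
        by (simp add: algebra_simps)
      also have "\<dots> = - (h *\<^sub>R v)"
        by (simp only: c(3))
      finally show ?thesis
        by simp
    qed
    moreover have "y + h *\<^sub>R v + (- (1 + h) *\<^sub>R v) = y - v"
      by (simp add: algebra_simps)
    ultimately show "F y - F (y + h *\<^sub>R v) \<le> c *\<^sub>R (F (y - v) - F (y + h *\<^sub>R v))"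
      using convex_op_increment[OF F c(1,2), of "y + h *\<^sub>R v" "- (1 + h) *\<^sub>R v"] by metis
  qed (use h in simp)
  also have "\<dots> = h *\<^sub>R (F (y - v) - F (y + h *\<^sub>R v))"
    using c(3) by (simp add: mult.commute)
  finally have "h *\<^sub>R (F y - F (y - v)) \<le> F (y + h *\<^sub>R v) - F y"
    by (simp add: algebra_simps)
  then show ?thesis
    using h by (simp add: pos_le_divideR_eq)
qed

lemma convex_op_quotient_mono:
  assumes F: "convex_op F" and h: "0 < h" "h \<le> k"
  shows "(F (y + h *\<^sub>R v) - F y) /\<^sub>R h \<le> (F (y + k *\<^sub>R v) - F y) /\<^sub>R k"
proof -
  have "F (y + h *\<^sub>R v) - F y \<le> (h / k) *\<^sub>R (F (y + k *\<^sub>R v) - F y)"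
    using convex_op_increment[OF F, of "h / k" y "k *\<^sub>R v"] h by simp
  also have "\<dots> = h *\<^sub>R ((F (y + k *\<^sub>R v) - F y) /\<^sub>R k)"
    by (simp add: divide_inverse)
  finally show ?thesis
    using h by (simp add: pos_divideR_le_eq)
qed

text \<open>Both families of quotients decrease in \<open>n\<close>. Each limit is at most every quotient of the other family:
  with \<open>k\<close> fixed, \<open>a n\<close> is dominated by \<open>sup (a n) (b k)\<close>, which decreases to \<open>b k\<close> in \<open>X\<close>.\<close>

lemma convex_op_quotients_asymptotic:
  fixes \<iota> :: "'a::banach_lattice \<Rightarrow> 'b::riesz_space"
  assumes \<iota>: "riesz_embedding \<iota>" and \<mu>: "\<mu> \<in> M_functionals \<iota>"
    and F: "convex_op F" "mono F" "\<And>x. isCont F x"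
    and cfa: "\<And>x. decr_to \<iota> (\<lambda>n. \<iota> (x n)) 0 \<Longrightarrow> decr_to \<iota> (\<lambda>n. \<iota> (F (x n))) (\<iota> (F 0))"
    and h: "null_seq_pos h"
    and a: "decr_to \<iota> (\<lambda>n. \<iota> (a n)) z" and b: "decr_to \<iota> (\<lambda>n. \<iota> (b n)) z"
  shows "(\<lambda>n. \<mu> (F (y + h n *\<^sub>R a n) - F (y + h n *\<^sub>R b n)) / h n) \<longlonglongrightarrow> 0"
proof -
  note lin = linear_diff[OF M_functionalsD(2)[OF \<mu>]] linear_cmul[OF M_functionalsD(2)[OF \<mu>]]
  have h0: "h n > 0" and hdec: "m \<le> n \<Longrightarrow> h n \<le> h m" for m n
    using h by (auto simp: null_seq_pos_def real_decr_to_def decseq_def)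
  define q where "q c n = \<mu> ((F (y + h n *\<^sub>R c n) - F y) /\<^sub>R h n)" for c n
  have conv: "q c \<longlonglongrightarrow> lim (q c)" and le: "m \<le> n \<Longrightarrow> q c n \<le> \<mu> ((F (y + h m *\<^sub>R c n) - F y) /\<^sub>R h m)"
    and dec: "decseq (q c)"
    if c: "decr_to \<iota> (\<lambda>n. \<iota> (c n)) z" for c m n
  proof -
    have F_mono: "(F (y + h m *\<^sub>R u) - F y) /\<^sub>R h m \<le> (F (y + h m *\<^sub>R v) - F y) /\<^sub>R h m"
      if "u \<le> v" for m u v
      using that h0[of m] by (intro scaleR_left_mono diff_right_mono) (auto intro!: monoD[OF F(2)] scaleR_left_mono)
    show le: "q c n \<le> \<mu> ((F (y + h m *\<^sub>R c n) - F y) /\<^sub>R h m)" if "m \<le> n" for m n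
      unfolding q_def using that h0 hdec
      by (intro M_functionalsD(3)[OF \<mu>] convex_op_quotient_mono F)
    show dec: "decseq (q c)"
      unfolding decseq_def
    proof (intro allI impI)
      fix m n :: nat assume "m \<le> n"
      then show "q c n \<le> q c m"
        using le[of m n] decr_toD(1)[OF \<iota> c] F_mono[of "c n" "c m" m]
        by (metis M_functionalsD(3)[OF \<mu>] decseqD order_trans q_def)
    qed
    obtain v where v: "\<And>n. v \<le> c n"
      using decr_toD(3)[OF \<iota> c] by blast
    \<comment> \<open>Monotonicity of \<open>F\<close> replaces the moving direction
      \<open>c n\<close> by its lower bound \<open>v\<close>, after which the lower bound is the
      same for all \<open>n\<close>.\<close>
    have "\<mu> (F y - F (y - v)) \<le> q c n" for n
      unfolding q_def using F_mono[OF v, of n n] convex_op_quotient_lower_bound[OF F(1) h0[of n], of y v]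
      by (intro M_functionalsD(3)[OF \<mu>]) (rule order_trans)
    then show "q c \<longlonglongrightarrow> lim (q c)"
      using decseq_convergent[OF dec] by (metis convergentI convergent_LIMSEQ_iff)
  qed
  have lim_le: "lim (q c) \<le> lim (q d)"
    if c: "decr_to \<iota> (\<lambda>n. \<iota> (c n)) z" and d: "decr_to \<iota> (\<lambda>n. \<iota> (d n)) z" for c d
  proof -
    have "lim (q c) \<le> q d k" for k
    proof (rule LIMSEQ_le_const)
      have "z \<le> \<iota> (d k)"
        using decr_toD(2)[OF \<iota> d] .
      note x = decr_to_affine[OF \<iota> decr_to_sup[OF \<iota> c this] h0[of k], of y]
      have "(\<lambda>n. \<mu> (F (y + h k *\<^sub>R sup (c n) (d k)))) \<longlonglongrightarrow> \<mu> (F (y + h k *\<^sub>R d k))"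
        by (rule convex_op_continuous_from_above[OF \<iota> \<mu> F _ x]) (rule cfa)
      then show "(\<lambda>n. \<mu> ((F (y + h k *\<^sub>R sup (c n) (d k)) - F y) /\<^sub>R h k)) \<longlonglongrightarrow> q d k"
        unfolding q_def lin by (intro tendsto_intros)
      have "lim (q c) \<le> \<mu> ((F (y + h k *\<^sub>R sup (c n) (d k)) - F y) /\<^sub>R h k)" if "n \<ge> k" for n
      proof -
        have "lim (q c) \<le> q c n"
          by (rule decseq_ge[OF dec[OF c] conv[OF c]])
        also have "\<dots> \<le> \<mu> ((F (y + h k *\<^sub>R c n) - F y) /\<^sub>R h k)"
          using le[OF c that] .
        also have "\<dots> \<le> \<mu> ((F (y + h k *\<^sub>R sup (c n) (d k)) - F y) /\<^sub>R h k)"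
          using h0[of k]
          by (intro M_functionalsD(3)[OF \<mu>] scaleR_left_mono diff_right_mono)
            (auto intro!: monoD[OF F(2)] scaleR_left_mono)
        finally show ?thesis .
      qed
      then show "\<exists>N. \<forall>n\<ge>N. lim (q c) \<le> \<mu> ((F (y + h k *\<^sub>R sup (c n) (d k)) - F y) /\<^sub>R h k)"
        by blast
    qed
    then show ?thesis
      by (intro LIMSEQ_le_const[OF conv[OF d]]) auto
  qed
  have "lim (q a) - lim (q b) = 0"
    using lim_le[OF a b] lim_le[OF b a] by simp
  then have "(\<lambda>n. q a n - q b n) \<longlonglongrightarrow> 0"
    using tendsto_diff[OF conv[OF a] conv[OF b]] by metis
  then show ?thesis
    by (simp add: q_def lin divide_inverse algebra_simps)
qed

subsection \<open>The monotone generator\<close>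

text \<open>The limit depends only on the difference quotients and no longer on the approximating
  sequence \<open>a\<close>. This is the source of all uniqueness statements for the monotone
  generator.\<close>

lemma mono_gen_along_functional:
  fixes \<iota> :: "'a::banach_lattice \<Rightarrow> 'b::riesz_space"
  assumes \<iota>: "riesz_embedding \<iota>" and gen: "mono_gen_along \<iota> S h x y"
    and \<mu>: "\<mu> \<in> M_functionals \<iota>" and \<nu>: "delta_extension \<iota> \<mu> \<nu>"
  shows "(\<lambda>n. \<mu> (diff_quot S (h n) x)) \<longlonglongrightarrow> \<nu> y"
proof -
  obtain a where y: "y \<in> X_delta \<iota>" and a: "decr_to \<iota> (\<lambda>n. \<iota> (a n)) y"
    and q: "(\<lambda>n. norm (diff_quot S (h n) x - a n)) \<longlonglongrightarrow> 0"
    using gen by (auto simp: mono_gen_along_def)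
  have "\<forall>u v. (\<forall>n. u n \<in> X_delta \<iota>) \<longrightarrow> v \<in> X_delta \<iota> \<longrightarrow> decr_to \<iota> u v \<longrightarrow>
      real_decr_to (\<lambda>n. \<nu> (u n)) (\<nu> v)"
    using \<nu> by (simp add: delta_extension_def)
  from this[rule_format, OF _ y a] have "real_decr_to (\<lambda>n. \<nu> (\<iota> (a n))) (\<nu> y)"
    by (simp add: embedding_in_X_delta[OF \<iota>])
  then have lim: "(\<lambda>n. \<mu> (a n)) \<longlonglongrightarrow> \<nu> y"
    using \<nu> by (simp add: real_decr_to_def delta_extension_def)
  have "(\<lambda>n. \<mu> (diff_quot S (h n) x - a n)) \<longlonglongrightarrow> 0"
    using q by (intro bounded_linear.tendsto_zero[OF M_functionalsD(1)[OF \<mu>]]) (rule tendsto_norm_zero_cancel)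
  from tendsto_add[OF this lim] show ?thesis
    by (simp add: linear_diff[OF M_functionalsD(2)[OF \<mu>]])
qed

text \<open>A single null sequence that shares a subsequence with each of two given ones lets their
  limits be compared.\<close>

lemma null_seq_pos_interlace:
  assumes h: "null_seq_pos h" and h': "null_seq_pos h'"
  obtains k p where "null_seq_pos k" "strict_mono p"
    "\<And>j. k (2 * j) = h (p (2 * j))" "\<And>j. k (2 * j + 1) = h' (p (2 * j + 1))"
proof -
  define u where "u j = (if even j then h else h')" for j :: nat
  have u: "null_seq_pos (u j)" for j
    using h h' by (simp add: u_def)
  \<comment> \<open>Since the other sequence tends to 0, an index beyond the previous one can be
    chosen at which it has fallen below the previous value. The conjunct \<open>True\<close> is the
    trivial invariant of the choice principle.\<close>
  have "\<exists>p. \<forall>j. True \<and> p j < p (Suc j) \<and> u (Suc j) (p (Suc j)) \<le> u j (p j)"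
  proof (rule dependent_nat_choice)
    fix m j :: nat
    have "\<forall>\<^sub>F n in sequentially. u (Suc j) n < u j m"
      using u[of j] u[of "Suc j"] by (intro order_tendstoD) (auto simp: null_seq_pos_def real_decr_to_def)
    then have "\<forall>\<^sub>F n in sequentially. m < n \<and> u (Suc j) n < u j m"
      using eventually_gt_at_top by (rule eventually_conj[rotated])
    then show "\<exists>n. True \<and> m < n \<and> u (Suc j) n \<le> u j m"
      using eventually_happens'[OF sequentially_bot] less_imp_le by blast
  qed simp
  then obtain p where p: "\<And>j. p j < p (Suc j)" "\<And>j. u (Suc j) (p (Suc j)) \<le> u j (p j)"
    by blast
  have sm: "strict_mono p"
    using p(1) by (simp add: strict_mono_Suc_iff)
  define k where "k j = u j (p j)" for j
  have k0: "0 < k j" for j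
    using u[of j] by (simp add: k_def null_seq_pos_def)
  \<comment> \<open>As \<open>p j\<close> is at least \<open>j\<close>, each term is at most the
    \<open>j\<close>-th term of one of the two sequences.\<close>
  have "norm (k j) \<le> h j + h' j" for j
  proof -
    have "u j (p j) \<le> u j j"
      using u[of j] seq_suble[OF sm, of j] by (auto simp: null_seq_pos_def real_decr_to_def intro: decseqD)
    then have "norm (k j) \<le> u j j"
      using k0[of j] by (simp add: k_def)
    also have "\<dots> \<le> h j + h' j"
      using h h' by (auto simp: u_def null_seq_pos_def intro: less_imp_le)
    finally show ?thesis .
  qed
  moreover have "(\<lambda>j. h j + h' j) \<longlonglongrightarrow> 0"
    using h h' tendsto_add[of h 0 sequentially h' 0] by (auto simp: null_seq_pos_def real_decr_to_def)
  ultimately have "k \<longlonglongrightarrow> 0"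
    by (rule Lim_null_comparison[OF always_eventually, OF allI])
  moreover have "decseq k"
    using p(2) by (simp add: decseq_Suc_iff k_def)
  ultimately show ?thesis
    using that[of k p] k0 sm by (simp add: null_seq_pos_def real_decr_to_def k_def u_def)
qed

text \<open>The limit \<open>z\<close> along the interlaced sequence is also tested along its even
  and its odd terms. Every functional in M then gives \<open>y\<close> and \<open>y'\<close> the
  same value as \<open>z\<close>, and M separates points.\<close>

lemma mono_gen_along_unique:
  fixes \<iota> :: "'a::banach_lattice \<Rightarrow> 'b::riesz_space"
  assumes \<iota>: "riesz_embedding \<iota>" and sep: "M_separates \<iota>" and x: "x \<in> mono_generator_dom \<iota> S"
    and h: "null_seq_pos h" "mono_gen_along \<iota> S h x y" and h': "null_seq_pos h'" "mono_gen_along \<iota> S h' x y'"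
  shows "y = y'"
proof -
  obtain k p where k: "null_seq_pos k" and p: "strict_mono p"
    "\<And>j. k (2 * j) = h (p (2 * j))" "\<And>j. k (2 * j + 1) = h' (p (2 * j + 1))"
    using null_seq_pos_interlace[OF h(1) h'(1)] by metis
  obtain z where z: "mono_gen_along \<iota> S k x z"
    using x k by (auto simp: mono_generator_dom_def)
  have eq: "y = z"
    if y: "mono_gen_along \<iota> S h x y" and r: "strict_mono r" "strict_mono q" "\<And>j. k (q j) = h (r j)"
    for h y and r q :: "nat \<Rightarrow> nat"
  proof (rule ccontr)
    assume "y \<noteq> z"
    moreover have "y \<in> X_delta \<iota>" "z \<in> X_delta \<iota>"
      using y z by (auto simp: mono_gen_along_def)
    ultimately obtain \<mu> \<nu> where \<mu>: "\<mu> \<in> M_functionals \<iota>" "delta_extension \<iota> \<mu> \<nu>" "\<nu> y \<noteq> \<nu> z"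
      using sep unfolding M_separates_def by metis
    have "(\<lambda>j. \<mu> (diff_quot S (h (r j)) x)) \<longlonglongrightarrow> \<nu> y"
      using LIMSEQ_subseq_LIMSEQ[OF mono_gen_along_functional[OF \<iota> y \<mu>(1,2)] r(1)] by (simp add: o_def)
    moreover have "(\<lambda>j. \<mu> (diff_quot S (k (q j)) x)) \<longlonglongrightarrow> \<nu> z"
      using LIMSEQ_subseq_LIMSEQ[OF mono_gen_along_functional[OF \<iota> z \<mu>(1,2)] r(2)] by (simp add: o_def)
    ultimately show False
      using \<mu>(3) LIMSEQ_unique by (simp add: r(3)) blast
  qed
  have "y = z"
    by (rule eq[OF h(2), of "\<lambda>j. p (2 * j)" "\<lambda>j. 2 * j"]) (use p in \<open>auto simp: strict_mono_def\<close>)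
  moreover have "y' = z"
    by (rule eq[OF h'(2), of "\<lambda>j. p (2 * j + 1)" "\<lambda>j. 2 * j + 1"]) (use p in \<open>auto simp: strict_mono_def\<close>)
  ultimately show ?thesis by simp
qed

lemma mono_gen_along_mono_generator:
  fixes \<iota> :: "'a::banach_lattice \<Rightarrow> 'b::riesz_space"
  assumes \<iota>: "riesz_embedding \<iota>" and sep: "M_separates \<iota>" and x: "x \<in> mono_generator_dom \<iota> S"
    and h: "null_seq_pos h"
  shows "mono_gen_along \<iota> S h x (mono_generator \<iota> S x)"
proof -
  obtain y where y: "mono_gen_along \<iota> S h x y"
    using x h by (auto simp: mono_generator_dom_def)
  have all: "mono_gen_along \<iota> S h' x y" if h': "null_seq_pos h'" for h'
    using x h' mono_gen_along_unique[OF \<iota> sep x h y h'] by (auto simp: mono_generator_dom_def)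
  have "mono_generator \<iota> S x = y"
    unfolding mono_generator_def
    using all mono_gen_along_unique[OF \<iota> sep x h _ h y] h by (intro the_equality) auto
  then show ?thesis
    using y by simp
qed

section \<open>Orbits and the domain of the monotone generator\<close>

lemma sigma_complete_glb_exists:
  fixes x :: "nat \<Rightarrow> 'b::sigma_complete_riesz_space"
  assumes "\<And>n. z \<le> x n"
  obtains y where "is_glb (range x) y"
proof -
  have "\<exists>s. (\<forall>c\<in>range (\<lambda>n. - x n). c \<le> s) \<and> (\<forall>b. (\<forall>c\<in>range (\<lambda>n. - x n). c \<le> b) \<longrightarrow> s \<le> b)"
    using assms by (intro countable_bounded_has_sup) (auto intro!: exI[of _ "- z"])
  then obtain s where s: "\<And>n. - x n \<le> s" "\<And>b. (\<And>n. - x n \<le> b) \<Longrightarrow> s \<le> b"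
    by auto
  have "is_glb (range x) (- s)"
    unfolding is_glb_def
  proof safe
    show "- s \<le> x n" for n
      using s(1)[of n] by (simp add: minus_le_iff)
    fix w assume "\<forall>c\<in>range x. w \<le> c"
    then have "s \<le> - w"
      by (intro s(2)) auto
    then show "w \<le> - s"
      by (simp add: le_minus_iff)
  qed
  then show ?thesis using that by blast
qed

lemma tendsto_null_seq_pos:
  assumes "(f \<longlongrightarrow> l) (at_right 0)" "null_seq_pos h"
  shows "(\<lambda>n. f (h n)) \<longlonglongrightarrow> l"
proof (rule filterlim_compose[OF assms(1)])
  show "filterlim h (at_right 0) sequentially"
    using assms(2) 
    by (auto simp: filterlim_at null_seq_pos_def real_decr_to_def less_imp_neq[symmetric]
        intro!: always_eventually)
qed

text \<open>The approximating sequence consists of the quotients of \<open>T s\<close> at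
  \<open>x\<close> in the direction \<open>w\<close>. Convexity makes it decreasing and bounded
  below, and sigma-completeness supplies the infimum in the ambient space.\<close>

lemma orbit_in_mono_generator_dom:
  fixes \<iota> :: "'a::banach_lattice \<Rightarrow> 'b::sigma_complete_riesz_space"
  assumes \<iota>: "riesz_embedding \<iota>" and T: "convex_C0_semigroup T"
    and x: "generator_graph T x w" and s: "s \<ge> 0"
  shows "T s x \<in> mono_generator_dom \<iota> T"
proof -
  have "\<exists>y. mono_gen_along \<iota> T h (T s x) y" if h: "null_seq_pos h" for h
  proof -
    have h0: "0 < h n" and hdec: "m \<le> n \<Longrightarrow> h n \<le> h m" for m n
      using h by (auto simp: null_seq_pos_def real_decr_to_def decseq_def)
    have h_lim: "h \<longlonglongrightarrow> 0"
      using h by (simp add: null_seq_pos_def real_decr_to_def)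
    have cvx: "convex_op (T s)"
      using convex_C0_semigroupD(2)[OF T s] .
    define a where "a n = (T s (x + h n *\<^sub>R w) - T s x) /\<^sub>R h n" for n
    have dec: "decseq a"
      unfolding decseq_def a_def using h0 hdec by (blast intro: convex_op_quotient_mono[OF cvx])
    have low: "T s x - T s (x - w) \<le> a n" for n
      unfolding a_def using convex_op_quotient_lower_bound[OF cvx h0] .
    have "\<iota> (T s x - T s (x - w)) \<le> \<iota> (a n)" for n
      using low by (simp add: riesz_embedding_le_iff[OF \<iota>])
    then obtain y where y: "is_glb (range (\<lambda>n. \<iota> (a n))) y"
      by (rule sigma_complete_glb_exists)
    have a: "decr_to \<iota> (\<lambda>n. \<iota> (a n)) y"
      using dec low y by (intro decr_toI[OF \<iota>]) (auto simp: is_glb_def)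
    have "(\<lambda>n. diff_quot T (h n) (T s x) - a n) \<longlonglongrightarrow> 0"
    proof -
      have q: "(\<lambda>n. diff_quot T (h n) x) \<longlonglongrightarrow> w"
        using x h unfolding generator_graph_def by (rule tendsto_null_seq_pos)
      obtain r L where L: "r > 0" "L \<ge> 0" "\<And>t u v. 0 \<le> t \<Longrightarrow> t \<le> s \<Longrightarrow> u \<in> cball x r \<Longrightarrow> v \<in> cball x r \<Longrightarrow>
          norm (T t u - T t v) \<le> L * norm (u - v)"
        using semigroup_locally_lipschitz[OF T] by metis
      have "(\<lambda>n. T (h n) x) \<longlonglongrightarrow> x"
        using convex_C0_semigroupD(5)[OF T] h by (rule tendsto_null_seq_pos)
      then have "\<forall>\<^sub>F n in sequentially. T (h n) x \<in> cball x r"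
        using L(1) by (auto dest!: tendstoD elim!: eventually_mono simp: dist_commute less_imp_le)
      moreover have "(\<lambda>n. x + h n *\<^sub>R w) \<longlonglongrightarrow> x + 0 *\<^sub>R w"
        by (intro tendsto_intros h_lim)
      then have "\<forall>\<^sub>F n in sequentially. x + h n *\<^sub>R w \<in> cball x r"
        using L(1) by (auto dest!: tendstoD elim!: eventually_mono simp: dist_commute less_imp_le)
      ultimately have "\<forall>\<^sub>F n in sequentially.
        norm (diff_quot T (h n) (T s x) - a n) \<le> L * norm (diff_quot T (h n) x - w)"
      proof eventually_elim
        case (elim n)
        \<comment> \<open>Commuting the operators puts the fixed \<open>T s\<close> outside. Its
          Lipschitz bound then compares \<open>T (h n) x\<close> with the first-order expansion
          \<open>x + h n w\<close>.\<close>
        have "T (h n) (T s x) = T s (T (h n) x)"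
          using convex_C0_semigroupD(4)[OF T, of s "h n" x] convex_C0_semigroupD(4)[OF T, of "h n" s x] s h0[of n]
          by (simp add: add.commute less_imp_le)
        then have "diff_quot T (h n) (T s x) - a n = (T s (T (h n) x) - T s (x + h n *\<^sub>R w)) /\<^sub>R h n"
          by (simp add: diff_quot_def a_def algebra_simps)
        also have "norm \<dots> \<le> (L * norm (T (h n) x - (x + h n *\<^sub>R w))) / h n"
          using divide_right_mono[OF L(3)[OF s order_refl elim], of "h n"] h0[of n]
          by (simp add: divide_inverse mult.commute)
        also have "T (h n) x - (x + h n *\<^sub>R w) = h n *\<^sub>R (diff_quot T (h n) x - w)"
          using h0[of n] by (simp add: diff_quot_def algebra_simps)
        also have "L * norm \<dots> / h n = L * norm (diff_quot T (h n) x - w)"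
          using h0[of n] by simp
        finally show ?case .
      qed
      moreover have "(\<lambda>n. L * norm (diff_quot T (h n) x - w)) \<longlonglongrightarrow> 0"
        using q by (intro tendsto_mult_right_zero tendsto_norm_zero LIM_zero)
      ultimately show ?thesis
        by (rule Lim_null_comparison)
    qed
    then have "mono_gen_along \<iota> T h (T s x) y"
      using a by (auto simp: mono_gen_along_def X_delta_def intro: tendsto_norm_zero)
    then show ?thesis by blast
  qed
  then show ?thesis
    by (simp add: mono_generator_dom_def)
qed

subsection \<open>Comparison of the semigroups\<close>

lemma mono_gen_along_expansion:
  fixes \<iota> :: "'a::banach_lattice \<Rightarrow> 'b::riesz_space"
  assumes \<iota>: "riesz_embedding \<iota>" and gen: "mono_gen_along \<iota> U h y z" and h: "null_seq_pos h"
  obtains a K where "decr_to \<iota> (\<lambda>n. \<iota> (a n)) z" "(\<lambda>n. diff_quot U (h n) y - a n) \<longlonglongrightarrow> 0"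
    "\<And>n. norm (diff_quot U (h n) y) \<le> K" "(\<lambda>n. y + h n *\<^sub>R a n) \<longlonglongrightarrow> y" "(\<lambda>n. U (h n) y) \<longlonglongrightarrow> y"
proof -
  have h0: "0 < h n" and h_lim: "h \<longlonglongrightarrow> 0" for n
    using h by (auto simp: null_seq_pos_def real_decr_to_def)
  obtain a where a: "decr_to \<iota> (\<lambda>n. \<iota> (a n)) z" and nq: "(\<lambda>n. norm (diff_quot U (h n) y - a n)) \<longlonglongrightarrow> 0"
    using gen by (auto simp: mono_gen_along_def)
  from nq have q: "(\<lambda>n. diff_quot U (h n) y - a n) \<longlonglongrightarrow> 0"
    by (rule tendsto_norm_zero_cancel)
  obtain v where v: "\<And>n. v \<le> a n"
    using decr_toD(3)[OF \<iota> a] by blast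
  \<comment> \<open>A decreasing sequence with a lower bound lies in an order interval and is
    therefore norm bounded. This bounds the difference quotients and forces \<open>U (h n) y\<close>
    to tend to \<open>y\<close>.\<close>
  have a_bd: "norm (a n) \<le> norm v + norm (a 0)" for n
    using v decr_toD(1)[OF \<iota> a] by (intro norm_le_of_order_bounds) (auto simp: decseq_def)
  obtain C where C: "\<And>n. norm (diff_quot U (h n) y - a n) \<le> C"
    using convergent_imp_Bseq[OF convergentI[OF q]] by (auto simp: Bseq_def)
  have bd: "norm (diff_quot U (h n) y) \<le> C + (norm v + norm (a 0))" for n
    using C[of n] a_bd[of n] norm_triangle_ineq[of "diff_quot U (h n) y - a n" "a n"] by simp
  have small: "(\<lambda>n. y + h n *\<^sub>R b n) \<longlonglongrightarrow> y" if b: "\<And>n. norm (b n) \<le> K" for b K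
  proof -
    have "(\<lambda>n. h n *\<^sub>R b n) \<longlonglongrightarrow> 0"
    proof (rule Lim_null_comparison)
      show "\<forall>\<^sub>F n in sequentially. norm (h n *\<^sub>R b n) \<le> h n * K"
        using b h0 by (auto intro!: always_eventually mult_left_mono simp: less_imp_le)
      show "(\<lambda>n. h n * K) \<longlonglongrightarrow> 0"
        using h_lim by (rule tendsto_mult_left_zero)
    qed
    then show ?thesis
      using tendsto_add[OF tendsto_const, of "\<lambda>n. h n *\<^sub>R b n" 0 sequentially y] by simp
  qed
  have "y + h n *\<^sub>R diff_quot U (h n) y = U (h n) y" for n
    using h0[of n] by (simp add: diff_quot_def)
  then show ?thesis
    using that[OF a q bd small[of a, OF a_bd]] small[of "\<lambda>n. diff_quot U (h n) y", OF bd] by simp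
qed

text \<open>Each of \<open>T (h n) y\<close> and \<open>S (h n) y\<close> is replaced by an
  expansion \<open>y + h n a n\<close> or \<open>y + h n b n\<close>, at a cost of smaller order
  than \<open>h n\<close> because \<open>S r\<close> is locally Lipschitz. Both \<open>a\<close> and
  \<open>b\<close> decrease to the same \<open>z\<close>, so the asymptotic equality of quotients
  applies.\<close>

lemma diff_quot_difference_vanishes:
  fixes \<iota> :: "'a::banach_lattice \<Rightarrow> 'b::riesz_space"
  assumes \<iota>: "riesz_embedding \<iota>" and \<mu>: "\<mu> \<in> M_functionals \<iota>"
    and S: "convex_C0_semigroup S" "monotone_semigroup S" "continuous_from_above \<iota> S"
    and h: "null_seq_pos h"
    and T_gen: "mono_gen_along \<iota> T h y z" and S_gen: "mono_gen_along \<iota> S h y z"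
    and r: "r \<ge> 0"
  shows "(\<lambda>n. \<mu> (S r (T (h n) y) - S r (S (h n) y)) / h n) \<longlonglongrightarrow> 0"
proof -
  note \<mu>_diff = linear_diff[OF M_functionalsD(2)[OF \<mu>]]
  have h0: "0 < h n" for n
    using h by (simp add: null_seq_pos_def)
  obtain \<rho> L where L: "\<rho> > 0" "L \<ge> 0" "\<And>t u v. 0 \<le> t \<Longrightarrow> t \<le> r \<Longrightarrow> u \<in> cball y \<rho> \<Longrightarrow> v \<in> cball y \<rho> \<Longrightarrow>
      norm (S t u - S t v) \<le> L * norm (u - v)"
    using semigroup_locally_lipschitz[OF S(1)] by metis
  have replace: "(\<lambda>n. \<mu> (S r (U (h n) y) - S r (y + h n *\<^sub>R a n)) / h n) \<longlonglongrightarrow> 0"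
    if q: "(\<lambda>n. diff_quot U (h n) y - a n) \<longlonglongrightarrow> 0"
      and lims: "(\<lambda>n. y + h n *\<^sub>R a n) \<longlonglongrightarrow> y" "(\<lambda>n. U (h n) y) \<longlonglongrightarrow> y" for U a
  proof -
    have ev: "\<forall>\<^sub>F n in sequentially. u n \<in> cball y \<rho>" if "u \<longlonglongrightarrow> y" for u
      using tendstoD[OF that L(1)] by eventually_elim (simp add: dist_commute)
    have "\<forall>\<^sub>F n in sequentially. norm ((S r (U (h n) y) - S r (y + h n *\<^sub>R a n)) /\<^sub>R h n)
        \<le> L * norm (diff_quot U (h n) y - a n)"
      using ev[OF lims(1)] ev[OF lims(2)]
    proof eventually_elim
      case (elim n)
      have eq: "U (h n) y - (y + h n *\<^sub>R a n) = h n *\<^sub>R (diff_quot U (h n) y - a n)"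
        using h0[of n] by (simp add: diff_quot_def algebra_simps)
      have "norm (S r (U (h n) y) - S r (y + h n *\<^sub>R a n)) / h n \<le> L * norm (U (h n) y - (y + h n *\<^sub>R a n)) / h n"
        using L(3)[OF r order_refl elim(2,1)] h0[of n] by (simp add: divide_right_mono)
      also have "\<dots> = L * norm (diff_quot U (h n) y - a n)"
        using h0[of n] by (simp add: eq)
      finally show ?case
        using h0[of n] by (simp add: divide_inverse mult.commute)
    qed
    moreover have "(\<lambda>n. L * norm (diff_quot U (h n) y - a n)) \<longlonglongrightarrow> 0"
      using q by (intro tendsto_mult_right_zero tendsto_norm_zero)
    ultimately have "(\<lambda>n. (S r (U (h n) y) - S r (y + h n *\<^sub>R a n)) /\<^sub>R h n) \<longlonglongrightarrow> 0"
      by (rule Lim_null_comparison)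
    then have "(\<lambda>n. \<mu> ((S r (U (h n) y) - S r (y + h n *\<^sub>R a n)) /\<^sub>R h n)) \<longlonglongrightarrow> 0"
      by (rule bounded_linear.tendsto_zero[OF M_functionalsD(1)[OF \<mu>]])
    then show ?thesis
      by (simp add: linear_cmul[OF M_functionalsD(2)[OF \<mu>]] divide_inverse mult.commute)
  qed
  obtain a Ka where a: "decr_to \<iota> (\<lambda>n. \<iota> (a n)) z" "(\<lambda>n. diff_quot T (h n) y - a n) \<longlonglongrightarrow> 0"
    "\<And>n. norm (diff_quot T (h n) y) \<le> Ka" "(\<lambda>n. y + h n *\<^sub>R a n) \<longlonglongrightarrow> y" "(\<lambda>n. T (h n) y) \<longlonglongrightarrow> y"
    by (rule mono_gen_along_expansion[OF \<iota> T_gen h]) blast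
  note ra = replace[OF a(2,4,5)]
  obtain b Kb where b: "decr_to \<iota> (\<lambda>n. \<iota> (b n)) z" "(\<lambda>n. diff_quot S (h n) y - b n) \<longlonglongrightarrow> 0"
    "\<And>n. norm (diff_quot S (h n) y) \<le> Kb" "(\<lambda>n. y + h n *\<^sub>R b n) \<longlonglongrightarrow> y" "(\<lambda>n. S (h n) y) \<longlonglongrightarrow> y"
    by (rule mono_gen_along_expansion[OF \<iota> S_gen h]) blast
  note rb = replace[OF b(2,4,5)]
  have "(\<lambda>n. \<mu> (S r (y + h n *\<^sub>R a n) - S r (y + h n *\<^sub>R b n)) / h n) \<longlonglongrightarrow> 0"
    using S r by (intro convex_op_quotients_asymptotic[OF \<iota> \<mu> _ _ _ _ h a(1) b(1)] convex_C0_semigroupD(2,6)[OF S(1)])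
      (auto simp: monotone_semigroup_def continuous_from_above_def)
  from tendsto_diff[OF tendsto_add[OF ra this] rb] show ?thesis
    by (simp add: \<mu>_diff diff_divide_distrib)
qed

text \<open>This is the majorant for dominated convergence in \<open>r\<close>: the Lipschitz
  constant is uniform for \<open>r\<close> up to \<open>R\<close>, and the bounded difference
  quotients cancel the division by \<open>h n\<close>.\<close>

lemma diff_quot_difference_bounded:
  fixes \<iota> :: "'a::banach_lattice \<Rightarrow> 'b::riesz_space"
  assumes \<iota>: "riesz_embedding \<iota>" and \<mu>: "\<mu> \<in> M_functionals \<iota>"
    and S: "convex_C0_semigroup S" and h: "null_seq_pos h"
    and T_gen: "mono_gen_along \<iota> T h y z" and S_gen: "mono_gen_along \<iota> S h y z"
  obtains C where
    "\<forall>\<^sub>F n in sequentially. \<forall>r\<in>{0..R}. \<bar>\<mu> (S r (T (h n) y) - S r (S (h n) y)) / h n\<bar> \<le> C"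
proof -
  have h0: "0 < h n" for n
    using h by (simp add: null_seq_pos_def)
  obtain \<rho> L where L: "\<rho> > 0" "L \<ge> 0" "\<And>t u v. 0 \<le> t \<Longrightarrow> t \<le> R \<Longrightarrow> u \<in> cball y \<rho> \<Longrightarrow> v \<in> cball y \<rho> \<Longrightarrow>
      norm (S t u - S t v) \<le> L * norm (u - v)"
    using semigroup_locally_lipschitz[OF S] by metis
  obtain K where K: "K \<ge> 0" "\<And>v. norm (\<mu> v) \<le> norm v * K"
    using bounded_linear.nonneg_bounded[OF M_functionalsD(1)[OF \<mu>]] by metis
  obtain C1 where C1: "\<And>n. norm (diff_quot T (h n) y) \<le> C1" and lim1: "(\<lambda>n. T (h n) y) \<longlonglongrightarrow> y"
    by (rule mono_gen_along_expansion[OF \<iota> T_gen h]) blast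
  obtain C2 where C2: "\<And>n. norm (diff_quot S (h n) y) \<le> C2" and lim2: "(\<lambda>n. S (h n) y) \<longlonglongrightarrow> y"
    by (rule mono_gen_along_expansion[OF \<iota> S_gen h]) blast
  have ev: "\<forall>\<^sub>F n in sequentially. u n \<in> cball y \<rho>" if "u \<longlonglongrightarrow> y" for u
    using tendstoD[OF that L(1)] by eventually_elim (simp add: dist_commute)
  have "\<forall>\<^sub>F n in sequentially. \<forall>r\<in>{0..R}. \<bar>\<mu> (S r (T (h n) y) - S r (S (h n) y)) / h n\<bar> \<le> L * (C1 + C2) * K"
    using ev[OF lim1] ev[OF lim2]
  proof eventually_elim
    case (elim n)
    show ?case
    proof
      fix r assume r: "r \<in> {0..R}"
      have "T (h n) y - S (h n) y = h n *\<^sub>R (diff_quot T (h n) y - diff_quot S (h n) y)"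
        using h0[of n] by (simp add: diff_quot_def algebra_simps)
      then have "norm (T (h n) y - S (h n) y) = h n * norm (diff_quot T (h n) y - diff_quot S (h n) y)"
        using h0[of n] by simp
      also have "\<dots> \<le> h n * (C1 + C2)"
        using h0[of n] C1[of n] C2[of n] norm_triangle_ineq4[of "diff_quot T (h n) y" "diff_quot S (h n) y"]
        by (intro mult_left_mono) auto
      finally have "norm (S r (T (h n) y) - S r (S (h n) y)) \<le> L * (h n * (C1 + C2))"
        using L(3)[of r, OF _ _ elim] r mult_left_mono[OF _ L(2)] by (smt (verit) atLeastAtMost_iff)
      then have "norm (\<mu> (S r (T (h n) y) - S r (S (h n) y))) \<le> L * (h n * (C1 + C2)) * K"
        using K(2) mult_right_mono[OF _ K(1)] order_trans by blast
      then show "\<bar>\<mu> (S r (T (h n) y) - S r (S (h n) y)) / h n\<bar> \<le> L * (C1 + C2) * K"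
        using h0[of n] by (simp add: pos_divide_le_eq mult.assoc mult.left_commute mult.commute)
    qed
  qed
  then show ?thesis by (rule that)
qed

text \<open>A continuation argument: the set \<open>A\<close> where the increment is at most
  \<open>\<epsilon> * s\<close> is compact, and at a maximal element below \<open>a\<close> the
  right derivative would allow a further step.\<close>

lemma constant_if_right_derivative_zero:
  fixes \<Phi> :: "real \<Rightarrow> real"
  assumes a: "0 \<le> a" and cont: "continuous_on {0..a} \<Phi>"
    and deriv: "\<And>s. 0 \<le> s \<Longrightarrow> s < a \<Longrightarrow> ((\<lambda>h. (\<Phi> (s + h) - \<Phi> s) / h) \<longlongrightarrow> 0) (at_right 0)"
  shows "\<Phi> a = \<Phi> 0"
proof -
  have "\<bar>\<Phi> a - \<Phi> 0\<bar> \<le> 0 + e" if e: "e > 0" for e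
  proof -
    \<comment> \<open>Dividing by \<open>a + 1\<close> instead of \<open>a\<close> also covers
      \<open>a = 0\<close>.\<close>
    define \<epsilon> where "\<epsilon> = e / (a + 1)"
    have \<epsilon>: "\<epsilon> > 0" "\<epsilon> * a \<le> e"
      using e a by (auto simp: \<epsilon>_def field_simps)
    define A where "A = {s \<in> {0..a}. \<bar>\<Phi> s - \<Phi> 0\<bar> \<le> \<epsilon> * s}"
    have "closed A"
      unfolding A_def by (intro continuous_on_closed_Collect_le continuous_intros cont closed_atLeastAtMost)
    moreover have "bounded A"
      by (rule bounded_subset[of "{0..a}"]) (auto simp: A_def)
    ultimately have "compact A"
      by (simp add: compact_eq_bounded_closed)
    moreover have "0 \<in> A"
      using a by (simp add: A_def)
    ultimately obtain s where s: "s \<in> A" "\<And>t. t \<in> A \<Longrightarrow> t \<le> s"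
      using compact_attains_sup[of A] by blast
    have "s = a"
    proof (rule ccontr)
      assume "s \<noteq> a"
      then have sa: "0 \<le> s" "s < a"
        using s(1) by (auto simp: A_def)
      have "\<forall>\<^sub>F h in at_right 0. dist ((\<Phi> (s + h) - \<Phi> s) / h) 0 < \<epsilon>"
        using deriv[OF sa] \<epsilon>(1) by (rule tendstoD)
      then obtain b where b: "b > 0" "\<And>h. 0 < h \<Longrightarrow> h < b \<Longrightarrow> \<bar>(\<Phi> (s + h) - \<Phi> s) / h\<bar> < \<epsilon>"
        by (auto simp: eventually_at_right_field)
      define h where "h = min (b / 2) (a - s)"
      have h: "0 < h" "h < b" "s + h \<le> a"
        using b(1) sa by (auto simp: h_def)
      have "\<bar>\<Phi> (s + h) - \<Phi> s\<bar> \<le> \<epsilon> * h"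
        using b(2)[OF h(1,2)] h(1) by (simp add: field_simps)
      then have "s + h \<in> A"
        using s(1) h by (auto simp: A_def algebra_simps)
      then show False
        using s(2) h(1) by fastforce
    qed
    then show ?thesis
      using s(1) \<epsilon>(2) by (simp add: A_def)
  qed
  then have "\<bar>\<Phi> a - \<Phi> 0\<bar> \<le> 0"
    by (rule field_le_epsilon)
  then show ?thesis by simp
qed

text \<open>The vanishing integral function has derivative \<open>f a\<close> at its left end
  point.\<close>

lemma zero_if_integrals_zero:
  fixes f :: "real \<Rightarrow> real"
  assumes cont: "continuous_on {a..a + 1} f" and int: "\<And>b. a < b \<Longrightarrow> integral {a..b} f = 0"
  shows "f a = 0"
proof -
  have "((\<lambda>u. integral {a..u} f) has_vector_derivative f a) (at a within {a..a + 1})"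
    by (rule integral_has_vector_derivative[OF cont]) simp
  moreover have "integral {a..u} f = 0" if "u \<in> {a..a + 1}" for u
    using int[of u] that by (cases "u = a") auto
  ultimately have "((\<lambda>u. 0) has_vector_derivative f a) (at a within {a..a + 1})"
    using has_vector_derivative_transform[of a "{a..a + 1}" "\<lambda>u. 0" "\<lambda>u. integral {a..u} f" "f a"] by simp
  then show ?thesis
    using vector_derivative_unique_within_closed_interval[of a "a + 1" a "\<lambda>u. 0 :: real" "f a" 0]
    by (simp add: has_vector_derivative_const)
qed

text \<open>For a fixed end point \<open>t\<close>, the one-sided derivative of \<open>s \<mapsto> \<mu> (S (t - s) (T s x))\<close> need not be
  accessible, since the operator \<open>S (t - s - h)\<close> moves with \<open>h\<close>. Averaging over \<open>t\<close> and substituting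
  \<open>r = t - s - h\<close> freezes the operator.\<close>

lemma functional_eq_on_generator_dom:
  fixes \<iota> :: "'a::banach_lattice \<Rightarrow> 'b::riesz_space"
  assumes \<iota>: "riesz_embedding \<iota>" and \<mu>: "\<mu> \<in> M_functionals \<iota>"
    and S: "convex_C0_semigroup S" "monotone_semigroup S" "continuous_from_above \<iota> S"
    and T: "convex_C0_semigroup T"
    and gen: "\<And>s h. s \<ge> 0 \<Longrightarrow> null_seq_pos h \<Longrightarrow>
      \<exists>z. mono_gen_along \<iota> T h (T s x) z \<and> mono_gen_along \<iota> S h (T s x) z"
    and t: "t \<ge> 0"
  shows "\<mu> (S t x) = \<mu> (T t x)"
proof -
  define g where "g r s = \<mu> (S r (T s x))" for r s
  have g: "continuous_on ({0..} \<times> {0..}) (\<lambda>(r, s). g r s)"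
  proof -
    have T_cont: "continuous_on ({0..} \<times> {0..}) (\<lambda>p::real \<times> real. T (snd p) x)"
      by (rule continuous_on_compose2[OF semigroup_jointly_continuous[OF T, unfolded case_prod_beta'],
          of _ "\<lambda>p. (snd p, x)", simplified]) (auto intro!: continuous_intros)
    have "continuous_on ({0..} \<times> {0..}) (\<lambda>p. S (fst p) (T (snd p) x))"
      by (rule continuous_on_compose2[OF semigroup_jointly_continuous[OF S(1), unfolded case_prod_beta'],
          of _ "\<lambda>p. (fst p, T (snd p) x)", simplified]) (auto intro!: continuous_intros T_cont)
    then show ?thesis
      unfolding g_def case_prod_beta' by (rule bounded_linear.continuous_on[OF M_functionalsD(1)[OF \<mu>]])
  qed
  have g_comp: "continuous_on A (\<lambda>u. g (p u) (q u))"
    if "continuous_on A p" "continuous_on A q" "\<And>u. u \<in> A \<Longrightarrow> 0 \<le> p u \<and> 0 \<le> q u"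
    for A :: "'c::topological_space set" and p q
    using continuous_on_compose2[OF g continuous_on_Pair[OF that(1,2)]] that(3) by force
  have deriv: "((\<lambda>h. (integral {t..b} (\<lambda>u. g (u - (s + h)) (s + h)) - integral {t..b} (\<lambda>u. g (u - s) s)) / h)
      \<longlongrightarrow> 0) (at_right 0)" if s: "0 \<le> s" "s < t" and b: "t < b" for s b
  proof (rule tendsto_at_right_sequentially)
    \<comment> \<open>Only steps below \<open>t - s\<close> are considered, so that
      \<open>u - (s + h n)\<close> remains nonnegative for every \<open>u\<close> at or above
      \<open>t\<close>.\<close>
    show "0 < t - s"
      using s by simp
    fix h :: "nat \<Rightarrow> real"
    assume h0: "\<And>n. 0 < h n" and ht: "\<And>n. h n < t - s" and h: "decseq h" "h \<longlonglongrightarrow> 0"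
    have h_null: "null_seq_pos h"
      using h0 h by (simp add: null_seq_pos_def real_decr_to_def)
    \<comment> \<open>The numerator compares a step of length \<open>h n\<close> along
      \<open>T\<close> with one along \<open>S\<close>, both followed by the same operator
      \<open>S r\<close>.\<close>
    define E where "E n r = (g r (s + h n) - g (r + h n) s) / h n" for n r
    have E_eq: "E n r = \<mu> (S r (T (h n) (T s x)) - S r (S (h n) (T s x))) / h n" if "r \<ge> 0" for n r
      using that s h0[of n] convex_C0_semigroupD(4)[OF T, of s "h n" x]
        convex_C0_semigroupD(4)[OF S(1), of "h n" r "T s x"]
      by (simp add: E_def g_def linear_diff[OF M_functionalsD(2)[OF \<mu>]] add.commute less_imp_le)
    obtain z where z: "mono_gen_along \<iota> T h (T s x) z" "mono_gen_along \<iota> S h (T s x) z"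
      using gen[OF s(1) h_null] by blast
    have E_lim: "(\<lambda>n. E n r) \<longlonglongrightarrow> 0" if "r \<ge> 0" for r
      using diff_quot_difference_vanishes[OF \<iota> \<mu> S h_null z that] by (simp add: E_eq[OF that])
    obtain C where "\<forall>\<^sub>F n in sequentially. \<forall>r\<in>{0..b}.
        \<bar>\<mu> (S r (T (h n) (T s x)) - S r (S (h n) (T s x))) / h n\<bar> \<le> C"
      by (rule diff_quot_difference_bounded[OF \<iota> \<mu> S(1) h_null z])
    then have "\<forall>\<^sub>F n in sequentially. \<forall>r\<in>{0..b}. \<bar>E n r\<bar> \<le> C"
      by (rule eventually_mono) (simp add: E_eq)
    then obtain N where N: "\<And>n r. n \<ge> N \<Longrightarrow> r \<in> {0..b} \<Longrightarrow> \<bar>E n r\<bar> \<le> C"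
      unfolding eventually_sequentially by blast
    have E_cont: "continuous_on {0..b} (E n)" for n
      unfolding E_def using s h0[of n] by (intro continuous_intros g_comp) auto
    \<comment> \<open>Absolute values over the fixed interval dominate the integrals over intervals
      moving with \<open>n\<close>. The shift by \<open>N\<close> is needed because the majorant
      holds only eventually.\<close>
    have "(\<lambda>n. integral {0..b} (\<lambda>r. \<bar>E (n + N) r\<bar>)) \<longlonglongrightarrow> integral {0..b} (\<lambda>r. 0 :: real)"
    proof (rule dominated_convergence)
      show "(\<lambda>r. \<bar>E (n + N) r\<bar>) integrable_on {0..b}" for n
        by (intro integrable_continuous_interval continuous_intros E_cont)
      show "(\<lambda>r. C) integrable_on {0..b}"
        by (rule integrable_const_ivl)
      show "norm \<bar>E (n + N) r\<bar> \<le> C" if "r \<in> {0..b}" for n r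
        using N that by simp
      show "(\<lambda>n. \<bar>E (n + N) r\<bar>) \<longlonglongrightarrow> 0" if "r \<in> {0..b}" for r
        using LIMSEQ_ignore_initial_segment[OF E_lim[of r], of N] that by (intro tendsto_rabs_zero) auto
    qed
    then have lim: "(\<lambda>n. integral {0..b} (\<lambda>r. \<bar>E n r\<bar>)) \<longlonglongrightarrow> 0"
      using LIMSEQ_offset[of "\<lambda>n. integral {0..b} (\<lambda>r. \<bar>E n r\<bar>)" N] by simp
    have "norm ((integral {t..b} (\<lambda>u. g (u - (s + h n)) (s + h n)) - integral {t..b} (\<lambda>u. g (u - s) s)) / h n)
        \<le> integral {0..b} (\<lambda>r. \<bar>E n r\<bar>)" for n
    proof -
      \<comment> \<open>The substitution \<open>r = u - (s + h n)\<close> carries both integrals to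
        the same interval \<open>I\<close> and turns their integrands into the two terms of
        \<open>E n r\<close>.\<close>
      define I where "I = {t - (s + h n)..b - (s + h n)}"
      have I: "I \<subseteq> {0..b}"
        using s h0[of n] ht[of n] by (auto simp: I_def)
      have shift: "integral {t..b} f = integral I (\<lambda>r. f (r + (s + h n)))" for f :: "real \<Rightarrow> real"
        using integral_shift_Icc_real[of "t - (s + h n)" "b - (s + h n)" f "s + h n"]
        by (simp add: I_def o_def add.commute)
      have sub: "f integrable_on I" if "continuous_on {0..b} f" for f :: "real \<Rightarrow> real"
        using continuous_on_subset[OF that I] by (simp add: I_def integrable_continuous_interval)
      have "integral {t..b} (\<lambda>u. g (u - (s + h n)) (s + h n)) - integral {t..b} (\<lambda>u. g (u - s) s)
          = integral I (\<lambda>r. g r (s + h n)) - integral I (\<lambda>r. g (r + h n) s)"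
        by (simp add: shift algebra_simps)
      also have "\<dots> = integral I (\<lambda>r. g r (s + h n) - g (r + h n) s)"
        using s h0[of n] by (intro integral_diff[symmetric] sub g_comp continuous_intros) auto
      also have "\<dots> = integral I (\<lambda>r. E n r * h n)"
        using h0[of n] by (simp add: E_def)
      also have "\<dots> = integral I (E n) * h n"
        by simp
      finally have "norm ((integral {t..b} (\<lambda>u. g (u - (s + h n)) (s + h n))
          - integral {t..b} (\<lambda>u. g (u - s) s)) / h n) = norm (integral I (E n))"
        using h0[of n] by simp
      also have "\<dots> \<le> integral I (\<lambda>r. \<bar>E n r\<bar>)"
        by (intro integral_norm_bound_integral sub E_cont continuous_intros) auto
      also have "\<dots> \<le> integral {0..b} (\<lambda>r. \<bar>E n r\<bar>)"
        using I by (intro integral_subset_le sub integrable_continuous_interval continuous_intros E_cont) auto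
      finally show ?thesis .
    qed
    from Lim_null_comparison[OF always_eventually, OF allI, OF this lim]
    show "(\<lambda>n. (integral {t..b} (\<lambda>u. g (u - (s + h n)) (s + h n)) - integral {t..b} (\<lambda>u. g (u - s) s)) / h n)
        \<longlonglongrightarrow> 0" .
  qed
  have int_eq: "integral {t..b} (\<lambda>u. g (u - t) t) = integral {t..b} (\<lambda>u. g (u - 0) 0)" if b: "t < b" for b
  proof (rule constant_if_right_derivative_zero[OF t])
    have "continuous_on ({0..t} \<times> {t..b}) (\<lambda>p. g (snd p - fst p) (fst p))"
      by (intro g_comp continuous_intros) auto
    then show "continuous_on {0..t} (\<lambda>s. integral {t..b} (\<lambda>u. g (u - s) s))"
      using integral_continuous_on_param[of "{0..t}" t b "\<lambda>s u. g (u - s) s"] by (simp add: case_prod_beta')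
  qed (use deriv b in simp)
  \<comment> \<open>The averages over \<open>{t..b}\<close> agree for every \<open>b > t\<close>, so
    the continuous integrands agree at \<open>u = t\<close>. There they equal
    \<open>\<mu> (S t x)\<close> and \<open>\<mu> (T t x)\<close>.\<close>
  have "g (t - 0) 0 - g (t - t) t = 0"
  proof (rule zero_if_integrals_zero[of t "\<lambda>u. g (u - 0) 0 - g (u - t) t"])
    have c: "continuous_on {t..b} (\<lambda>u. g (u - 0) 0)" "continuous_on {t..b} (\<lambda>u. g (u - t) t)" for b
      using t by (auto intro!: g_comp continuous_intros)
    show "continuous_on {t..t + 1} (\<lambda>u. g (u - 0) 0 - g (u - t) t)"
      by (intro continuous_on_diff c)
    show "integral {t..b} (\<lambda>u. g (u - 0) 0 - g (u - t) t) = 0" if "t < b" for b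
      using int_eq[OF that] integral_diff[OF integrable_continuous_interval[OF c(1)] integrable_continuous_interval[OF c(2)]]
      by simp
  qed
  then show ?thesis
    by (simp add: g_def convex_C0_semigroupD(3)[OF S(1)] convex_C0_semigroupD(3)[OF T])
qed

theorem corollary4p2:
  fixes \<iota> :: "'a::banach_lattice \<Rightarrow> 'b::sigma_complete_riesz_space"
    and S T :: "real \<Rightarrow> 'a \<Rightarrow> 'a"
  assumes "riesz_embedding \<iota>"
    and "M_separates \<iota>"
    and "convex_C0_semigroup S"
    and "monotone_semigroup S"
    and "continuous_from_above \<iota> S"
    and "convex_C0_semigroup T"
    and "mono_generator_dom \<iota> T \<subseteq> mono_generator_dom \<iota> S"
    and "\<And>x. x \<in> mono_generator_dom \<iota> T \<Longrightarrow> mono_generator \<iota> T x = mono_generator \<iota> S x"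
    and "closure (generator_dom T) = UNIV"
  shows "\<forall>t\<ge>0. \<forall>x. S t x = T t x"
proof (intro allI impI)
  note \<iota> = assms(1) and sep = assms(2) and S = assms(3-5) and T = assms(6)
  fix t :: real and x assume t: "t \<ge> 0"
  have on_dom: "S t x = T t x" if x: "x \<in> generator_dom T" for x
  proof (rule ccontr)
    obtain w where w: "generator_graph T x w"
      using x by (auto simp: generator_dom_def)
    \<comment> \<open>The orbit stays in the domain of the monotone generator of \<open>T\<close>;
      there both monotone generators are defined and agree, so their common value serves as
      \<open>z\<close>.\<close>
    have gen: "\<exists>z. mono_gen_along \<iota> T h (T s x) z \<and> mono_gen_along \<iota> S h (T s x) z"
      if "s \<ge> 0" "null_seq_pos h" for s h
    proof -
      have "T s x \<in> mono_generator_dom \<iota> T"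
        using orbit_in_mono_generator_dom[OF \<iota> T w \<open>s \<ge> 0\<close>] .
      then show ?thesis
        using assms(7,8) mono_gen_along_mono_generator[OF \<iota> sep] \<open>null_seq_pos h\<close> by (metis subsetD)
    qed
    assume "S t x \<noteq> T t x"
    then have "\<iota> (S t x) \<noteq> \<iota> (T t x)"
      using \<iota> by (simp add: riesz_embedding_def inj_eq)
    then obtain \<mu> \<nu> where \<mu>: "\<mu> \<in> M_functionals \<iota>" "delta_extension \<iota> \<mu> \<nu>"
      and "\<nu> (\<iota> (S t x)) \<noteq> \<nu> (\<iota> (T t x))"
      using sep embedding_in_X_delta[OF \<iota>] unfolding M_separates_def by metis
    then have "\<mu> (S t x) \<noteq> \<mu> (T t x)"
      by (simp add: delta_extension_def)
    then show False
      using functional_eq_on_generator_dom[OF \<iota> \<mu>(1) S T gen t] by blast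
  qed
  \<comment> \<open>Convex bounded operators are norm continuous, so equality extends from the dense
    domain to its closure.\<close>
  have "closed {x. S t x = T t x}"
    using convex_C0_semigroupD(6)[OF S(1) t] convex_C0_semigroupD(6)[OF T t]
    by (intro closed_Collect_eq) (simp_all add: continuous_on_eq_continuous_at)
  then have "closure (generator_dom T) \<subseteq> {x. S t x = T t x}"
    using on_dom by (intro closure_minimal) auto
  then show "S t x = T t x"
    using assms(9) by blast
qed

end
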